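(* Let $p,q,n$ be positive integers, $b\in\{1,-1\}$, and $a=(-1)^{p+q-1}$, with $p\neq 1$ when $a^nb=1$, and $q\neq 1$ when $a=1$. Then the following two identities hold. (i) $$\begin{aligned}\int_0^1\frac{\ln^{q-1}(x)\operatorname{Li}_p(bx^{2n})}{1-ax^2}\,\mathrm{d}x={}&-\tfrac12a^{n-1}b\,2^{-q}(q-1)!\,(1-(-1)^{p})\,\Phi(a,q,\tfrac12)\,\Phi(a^nb,p,1)\\ &+ab\,2^{-q}n^{p}(q-1)!\sum_{k=0}^{\lfloor p/2\rfloor}\binom{p+q-2k-1}{q-1}n^{-2k}\,\Phi(b,2k,1)\,\Phi(a,p+q-2k,\tfrac12)\\ &+\tfrac12a^{n-1}b\,(2n)^{-q}(q-1)!\sum_{j=1}^{n}\sum_{k=1}^{q}\binom{p+q-k-1}{p-1}a^j(-1)^{k}\,\Theta(b,k,2j-1,2n)\,\Phi\!\left(a^nb,p+q-k,\tfrac{2n-2j+1}{2n}\right);\end{aligned}$$ (ii) $$\begin{aligned}\int_0^1\frac{\ln^{q-1}(x)\operatorname{Li}_p(bx^{-2n})}{1-ax^2}\,\mathrm{d}x={}&-\tfrac12a^{n}b\,(-2)^{-q}(q-1)!\,(1-(-1)^{p})\,\Phi(a,q,\tfrac12)\,\Phi(a^nb,p,1)\\ &-b\,(-2)^{-q}n^{p}(q-1)!\sum_{k=0}^{\lfloor p/2\rfloor}\binom{p+q-2k-1}{q-1}n^{-2k}\,\Phi(b,2k,1)\,\Phi(a,p+q-2k,\tfrac12)\\ &+\tfrac12a^{n}b\,(-2n)^{-q}(q-1)!\sum_{j=1}^{n}\sum_{k=1}^{q}\binom{p+q-k-1}{p-1}a^j(-1)^{k}\,\Theta(b,k,2j-1,2n)\,\Phi\!\left(a^nb,p+q-k,\tfrac{2n-2j+1}{2n}\right).\end{aligned}$$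 The integral in (ii) is understood as a Cauchy principal value when $b=1$ (that is, $\operatorname{Li}_p$ at arguments $>1$ is given by its principal-value integral).
   Context: Polylogarithm: for real $x\le 1$, $\operatorname{Li}_p(x)=\frac{(-1)^{p-1}}{(p-1)!}\int_0^1\frac{x\ln^{p-1}(y)}{1-xy}\,\mathrm{d}y$; for $x>1$, $\operatorname{Li}_p(x)$ denotes the Cauchy principal value of the same integral (equivalently, the real part of the analytically continued polylogarithm). Lerch function: for $c=\pm1$, integer $q\ge1$ (with $q\neq1$ if $c=1$) and $\alpha>0$, $\Phi(c,q,\alpha)=\sum_{m=0}^\infty \frac{c^m}{(m+\alpha)^q}$. At $q=0$, $\alpha=1$ the values by analytic continuation are used: $\Phi(1,0,1)=\zeta(0)=-\tfrac12$ and $\Phi(-1,0,1)=\eta(0)=\tfrac12$. For $c=\pm1$, integer $k\ge 1$ and $0<s<r$: $\Theta(c,k,s,r)=\Phi(c,k,\tfrac{s}{r})+c(-1)^{k}\Phi(c,k,\tfrac{r-s}{r})$ if $(c,k)\ne(1,1)$, and $\Theta(1,1,s,r)=\pi\cot(\pi s/r)$. *)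

theory Defs
  imports "HOL-Analysis.Analysis"
begin

(* Principal value of the integral of f over [l, u] with a singularity at s, l < s < u. *)
definition pv_integral :: "real \<Rightarrow> real \<Rightarrow> real \<Rightarrow> (real \<Rightarrow> real) \<Rightarrow> real" where
  "pv_integral l s u f =
     Lim (at_right 0) (\<lambda>\<epsilon>. integral {l..s - \<epsilon>} f + integral {s + \<epsilon>..u} f)"

(* For x > 1 the integrand has its only pole in (0,1) at y = 1/x.  The order p is assumed
   to be positive. *)
definition Li :: "nat \<Rightarrow> real \<Rightarrow> real" where
  "Li p x = (-1) ^ (p - 1) / fact (p - 1) *
     (if x \<le> 1 then integral {0..1} (\<lambda>y. x * ln y ^ (p - 1) / (1 - x * y))
      else pv_integral 0 (1 / x) 1 (\<lambda>y. x * ln y ^ (p - 1) / (1 - x * y)))"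

(* Intended for c = 1 or c = -1 and \<alpha> > 0.  The values at q = 0, \<alpha> = 1 are those of the
   analytic continuation in q: zeta(0) = -1/2 for c = 1 and eta(0) = 1/2 for c = -1.
   For c = -1, q = 1 the series converges only conditionally; suminf is the limit of the
   partial sums. *)
definition Lerch :: "real \<Rightarrow> nat \<Rightarrow> real \<Rightarrow> real" where
  "Lerch c q \<alpha> =
     (if q = 0 \<and> \<alpha> = 1 then (if c = 1 then - 1 / 2 else 1 / 2)
      else (\<Sum>m. c ^ m / (real m + \<alpha>) ^ q))"

definition Theta :: "real \<Rightarrow> nat \<Rightarrow> real \<Rightarrow> real \<Rightarrow> real" where
  "Theta c k s r =
     (if c = 1 \<and> k = 1 then pi * cot (pi * s / r)
      else Lerch c k (s / r) + c * (-1) ^ k * Lerch c k ((r - s) / r))"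

end

theory Submission
  imports Defs "HOL-Real_Asymp.Real_Asymp"
begin

text \<open>Expanding both factors, the integral in (i) becomes \<open>(-1)\<^sup>q\<^sup>-\<^sup>1 (q-1)!\<close> times the double series
  \<open>S\<close> of \<open>b\<^sup>m a\<^sup>i / (m\<^sup>p (2nm + l)\<^sup>q)\<close> over \<open>m \<ge> 1\<close>, \<open>l = 2i + 1 > 0\<close>.  The sum over
  \<open>m < 0\<close> can be reduced to \<open>S\<close>: reflecting \<open>l - 2nm\<close> about \<open>0\<close> costs the sign
  \<open>a (-1)\<^sup>q = (-1)\<^sup>p\<^sup>-\<^sup>1\<close>, so the sum over all \<open>m \<noteq> 0\<close> equals \<open>2 S\<close> minus a product of two Lerch
  values.  On the other hand, for fixed \<open>l\<close> the sum over \<open>m \<noteq> 0\<close> is evaluated by partial fractions: the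
  poles at \<open>m = 0\<close> give the values \<open>Lerch b (2 k) 1\<close>, those at \<open>2nm = -l\<close> give \<open>Theta\<close>.
  Since \<open>p = 1\<close> and \<open>q = 1\<close> are allowed, the interchange of the two summations is only conditional;
  it is carried out along the truncations \<open>l < 2nN\<close>, with an error at most a multiple of
  \<open>\<Sum>m. 1 / (m (\<bar>N - m\<bar> + 1))\<close>.  Identity (ii) follows from (i) by the inversion formula relating
  \<open>Li\<close> at \<open>b / z\<close> and at \<open>b z\<close>.\<close>

section \<open>Lerch series and their tails\<close>

text \<open>The parity hypothesis on \<open>a\<close> keeps the argument from being void: with the
  opposite sign \<open>S\<close> would cancel from the sum over all \<open>m \<noteq> 0\<close>, and
  only a product of two Lerch values would be left. The cut \<open>l < 2nN\<close> is chosen because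
  shifting or reflecting by \<open>2nm\<close> then turns a truncated sum over odd \<open>l\<close>
  into truncated sums of the same series, cut after \<open>N + m\<close> and
  \<open>\<bar>N - m\<bar>\<close> blocks of \<open>n\<close> terms. Everything else cancels against
  the expected limit, so the error consists of series tails of order
  \<open>1 / (\<bar>N - m\<bar> + 1)\<close>. For \<open>p = q = 1\<close> neither these tails nor
  the weight \<open>1 / m\<close> can be improved, which leads to the convolution of two harmonic
  weights. The continued values at exponent 0 enter through one coincidence:
  \<open>2 * b * Lerch b 0 1 = -1\<close> for both signs of \<open>b\<close>. In the partial
  fractions this \<open>-1\<close> accounts for the omitted integer \<open>m = 0\<close>, in the
  inversion formula for the pure power of the logarithm; each time the leftover becomes the summand
  \<open>k = 0\<close>.\<close>

lemma alternating_sum_bounds: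
  fixes f :: "nat \<Rightarrow> real"
  assumes "\<And>i. 0 \<le> f i" "\<And>i. f (Suc i) \<le> f i"
  shows "0 \<le> (\<Sum>i<k. (-1) ^ i * f (m + i)) \<and> (\<Sum>i<k. (-1) ^ i * f (m + i)) \<le> f m"
proof (induction k arbitrary: m)
  case 0
  then show ?case using assms(1) by simp
next
  case (Suc k)
  \<comment> \<open>Dropping the first term flips every sign, so the rest is a sum of the same kind
    begun at \<open>Suc m\<close>; hence \<open>m\<close> stays arbitrary in the induction.\<close>
  have "(\<Sum>i<Suc k. (-1) ^ i * f (m + i)) = f m - (\<Sum>i<k. (-1) ^ i * f (Suc m + i))"
    by (subst sum.lessThan_Suc_shift) (simp add: sum_negf)
  then show ?case using Suc[of "Suc m"] assms(2)[of m] by simp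
qed

lemma alternating_series_tail:
  fixes f :: "nat \<Rightarrow> real"
  assumes nonneg: "\<And>i. 0 \<le> f i" and dec: "\<And>i. f (Suc i) \<le> f i" and lim: "f \<longlonglongrightarrow> 0"
  shows "summable (\<lambda>i. (-1) ^ i * f i)"
    and "\<bar>(\<Sum>i. (-1) ^ i * f i) - (\<Sum>i<m. (-1) ^ i * f i)\<bar> \<le> f m"
proof -
  show S: "summable (\<lambda>i. (-1) ^ i * f i)"
    by (rule summable_Leibniz(1)) (use assms in \<open>auto simp: monoseq_Suc\<close>)
  have S': "summable (\<lambda>i. (-1) ^ (m + i) * f (m + i))"
    using S summable_iff_shift[of "\<lambda>i. (-1) ^ i * f i" m] by (simp add: add.commute)
  have "(\<Sum>i. (-1) ^ i * f i) - (\<Sum>i<m. (-1) ^ i * f i) = (\<Sum>i. (-1) ^ (m + i) * f (m + i))"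
    using suminf_minus_initial_segment[OF S, of m] by (simp add: add.commute)
  also have "\<bar>\<dots>\<bar> \<le> f m"
  proof (rule LIMSEQ_le_const2)
    show "(\<lambda>k. \<bar>\<Sum>i<k. (-1) ^ (m + i) * f (m + i)\<bar>) \<longlonglongrightarrow> \<bar>\<Sum>i. (-1) ^ (m + i) * f (m + i)\<bar>"
      by (intro tendsto_rabs summable_LIMSEQ S')
    \<comment> \<open>Up to the sign \<open>(-1) ^ m\<close> this is an alternating sum begun at
      \<open>m\<close>, so the first omitted term bounds it whatever the parity of
      \<open>m\<close>.\<close>
    have "\<bar>\<Sum>i<k. (-1) ^ (m + i) * f (m + i)\<bar> \<le> f m" for k
      using alternating_sum_bounds[where f=f and k=k and m=m] nonneg dec
      by (simp add: power_add mult.assoc flip: sum_distrib_left) (simp add: abs_mult)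
    then show "\<exists>N. \<forall>n\<ge>N. \<bar>\<Sum>i<n. (-1) ^ (m + i) * f (m + i)\<bar> \<le> f m" by auto
  qed
  finally show "\<bar>(\<Sum>i. (-1) ^ i * f i) - (\<Sum>i<m. (-1) ^ i * f i)\<bar> \<le> f m" .
qed

lemma summable_inverse_shifted_power:
  assumes "q \<ge> 2" "\<alpha> > 0"
  shows "summable (\<lambda>m. 1 / (real m + \<alpha>) ^ q)"
proof (rule summable_comparison_test_ev)
  show "summable (\<lambda>m. inverse (real m ^ q))"
    using inverse_power_summable[OF assms(1), where 'a=real] .
  have "norm (1 / (real m + \<alpha>) ^ q) \<le> inverse (real m ^ q)" if "m \<ge> 1" for m
    using that assms by (auto simp: divide_inverse norm_inverse intro!: le_imp_inverse_le power_mono)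
  then show "\<forall>\<^sub>F m in sequentially. norm (1 / (real m + \<alpha>) ^ q) \<le> inverse (real m ^ q)"
    by (auto simp: eventually_at_top_linorder)
qed

text \<open>With \<open>q \<ge> 1\<close> the branch of \<open>Lerch\<close> holding a continued
  value is never met. The excluded case \<open>c = 1\<close>, \<open>q = 1\<close> is the harmonic
  series; for \<open>c = -1\<close> the Leibniz criterion gives convergence.\<close>

lemma Lerch_sums:
  assumes "c \<in> {1, -1}" "q \<ge> 1" "c = 1 \<longrightarrow> q \<noteq> 1" "\<alpha> > 0"
  shows "(\<lambda>m. c ^ m / (real m + \<alpha>) ^ q) sums Lerch c q \<alpha>"
proof -
  have "summable (\<lambda>m. c ^ m / (real m + \<alpha>) ^ q)"
  proof (cases "c = 1")
    case True
    then show ?thesis using assms summable_inverse_shifted_power[of q \<alpha>] by auto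
  next
    case False
    have "summable (\<lambda>m. (-1) ^ m * (1 / (real m + \<alpha>) ^ q))"
    proof (rule alternating_series_tail(1))
      show "1 / (real (Suc i) + \<alpha>) ^ q \<le> 1 / (real i + \<alpha>) ^ q" for i
        using assms by (intro divide_left_mono power_mono mult_pos_pos) auto
      have "filterlim (\<lambda>i. (real i + \<alpha>) ^ q) at_top sequentially"
        using assms(2) by (intro filterlim_pow_at_top) (auto, real_asymp)
      then show "(\<lambda>i. 1 / (real i + \<alpha>) ^ q) \<longlonglongrightarrow> 0"
        by (intro tendsto_divide_0[OF tendsto_const] filterlim_at_top_imp_at_infinity)
    qed (use assms in auto)
    then show ?thesis using assms False by simp
  qed
  then show ?thesis using assms by (auto simp: Lerch_def summable_sums)
qed

text \<open>One tail bound for all admissible \<open>c\<close> and \<open>q\<close>. For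
  \<open>c = 1\<close> the exponent is at least 2 and a telescoping series dominates; for
  \<open>c = -1\<close> the first omitted term does. The case \<open>c = -1\<close>,
  \<open>q = 1\<close> allows no faster rate than \<open>1 / m\<close>.\<close>

lemma odd_series_tail:
  fixes c :: real
  assumes "c \<in> {1, -1}" "q \<ge> 1" "c = 1 \<longrightarrow> q \<noteq> 1"
  shows "(\<lambda>i. c ^ i / (2 * real i + 1) ^ q) sums (Lerch c q (1/2) / 2 ^ q)"
    and "\<bar>Lerch c q (1/2) / 2 ^ q - (\<Sum>i<m. c ^ i / (2 * real i + 1) ^ q)\<bar> \<le> 2 / (real m + 1)"
proof -
  have "(\<lambda>m. c ^ m / (real m + 1/2) ^ q / 2 ^ q) sums (Lerch c q (1/2) / 2 ^ q)"
    by (intro sums_divide Lerch_sums) (use assms in auto)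
  moreover have "c ^ m / (real m + 1/2) ^ q / 2 ^ q = c ^ m / (2 * real m + 1) ^ q" for m
  proof -
    have "(real m + 1/2) ^ q * 2 ^ q = (2 * real m + 1) ^ q"
      by (simp add: algebra_simps flip: power_mult_distrib)
    then show ?thesis by simp
  qed
  ultimately show S: "(\<lambda>i. c ^ i / (2 * real i + 1) ^ q) sums (Lerch c q (1/2) / 2 ^ q)"
    by (simp only:)
  show "\<bar>Lerch c q (1/2) / 2 ^ q - (\<Sum>i<m. c ^ i / (2 * real i + 1) ^ q)\<bar> \<le> 2 / (real m + 1)"
  proof (cases "c = 1")
    case True
    then have q: "q \<ge> 2" using assms by auto
    let ?f = "\<lambda>i. 1 / (2 * real i + 1) ^ q"
    have sm: "summable ?f" using S True by (auto simp: sums_iff)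
    have "Lerch c q (1/2) / 2 ^ q - (\<Sum>i<m. c ^ i / (2 * real i + 1) ^ q) = (\<Sum>i. ?f (i + m))"
      using suminf_minus_initial_segment[OF sm, of m] S True by (simp add: sums_iff)
    moreover have "0 \<le> (\<Sum>i. ?f (i + m))"
      using summable_iff_shift[of ?f m] sm by (intro suminf_nonneg) auto
    moreover have "(\<Sum>i. ?f (i + m)) \<le> 2 / (real m + 1)"
    proof -
      let ?h = "\<lambda>i. 2 / (real (i + m) + 1)"
      have "?h \<longlonglongrightarrow> 0" by real_asymp
      then have h: "(\<lambda>i. ?h i - ?h (Suc i)) sums (?h 0 - 0)" by (rule telescope_sums')
      have "?f (i + m) \<le> ?h i - ?h (Suc i)" for i
      proof -
        define x where "x = real (i + m)"
        have x: "x \<ge> 0" by (simp add: x_def)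
        have "?f (i + m) \<le> 1 / (2 * x + 1) ^ 2"
          unfolding x_def using q by (intro divide_left_mono power_increasing mult_pos_pos) auto
        \<comment> \<open>Equality holds at \<open>x = 0\<close>, which fixes the constant 2 of the
          telescoping majorant.\<close>
        also have "\<dots> \<le> 2 / ((x + 1) * (x + 2))"
        proof -
          have "(x + 1) * (x + 2) \<le> 2 * (2 * x + 1) ^ 2"
            using x by (simp add: power2_eq_square algebra_simps)
          then show ?thesis using x by (simp add: divide_simps mult.commute)
        qed
        also have "\<dots> = 2 / (x + 1) - 2 / (x + 2)" using x by (simp add: field_simps)
        finally show ?thesis by (simp add: x_def algebra_simps)
      qed
      then show ?thesis
        using suminf_le[OF _ _ sums_summable[OF h], of "\<lambda>i. ?f (i + m)"] sums_unique[OF h]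
          summable_iff_shift[of ?f m] sm by simp
    qed
    ultimately show ?thesis by simp
  next
    case False
    then have c: "c = -1" using assms by auto
    let ?f = "\<lambda>i. 1 / (2 * real i + 1) ^ q"
    have "\<bar>(\<Sum>i. (-1) ^ i * ?f i) - (\<Sum>i<m. (-1) ^ i * ?f i)\<bar> \<le> ?f m"
    proof (rule alternating_series_tail(2))
      show "1 / (2 * real (Suc i) + 1) ^ q \<le> 1 / (2 * real i + 1) ^ q" for i
        using assms by (intro divide_left_mono power_mono mult_pos_pos) auto
      have "filterlim (\<lambda>i. (2 * real i + 1) ^ q) at_top sequentially"
        using assms(2) by (intro filterlim_pow_at_top) (auto, real_asymp)
      then show "?f \<longlonglongrightarrow> 0"
        by (intro tendsto_divide_0[OF tendsto_const] filterlim_at_top_imp_at_infinity)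
    qed auto
    also have "?f m \<le> 1 / (2 * real m + 1) ^ 1"
      using assms by (intro divide_left_mono power_increasing mult_pos_pos) auto
    also have "\<dots> \<le> 2 / (real m + 1)" by (simp add: field_simps)
    finally show ?thesis using S by (simp add: c sums_iff)
  qed
qed

section \<open>Decay of the convolution of two harmonic weights\<close>

lemma harmonic_convolution_summable:
  "summable (\<lambda>m. 1 / (real (Suc m) * (\<bar>real N - real (Suc m)\<bar> + 1)))"
proof (rule summable_comparison_test_ev)
  show "summable (\<lambda>m. (real N + 1) * (1 / (real m + 1) ^ 2))"
    by (intro summable_mult summable_inverse_shifted_power) auto
  have "norm (1 / (real (Suc m) * (\<bar>real N - real (Suc m)\<bar> + 1))) \<le> (real N + 1) * (1 / (real m + 1) ^ 2)" for m
  proof -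
    \<comment> \<open>This is the triangle inequality
      \<open>m + 1 \<le> N + \<bar>N - (m + 1)\<bar>\<close>, weakened to a product. The majorant it
      yields grows with \<open>N\<close>, so it gives convergence for fixed \<open>N\<close> but no
      decay.\<close>
    have "real (Suc m) \<le> (real N + 1) * (\<bar>real N - real (Suc m)\<bar> + 1)"
      by (simp add: algebra_simps) (smt (verit) mult_nonneg_nonneg of_nat_0_le_iff)
    then have "real (Suc m) * real (Suc m) \<le> (real N + 1) * (real (Suc m) * (\<bar>real N - real (Suc m)\<bar> + 1))"
      using mult_left_mono[of "real (Suc m)" _ "real (Suc m)"] by (simp add: mult_ac)
    then show ?thesis by (simp add: divide_simps power2_eq_square mult.commute add.commute)
  qed
  then show "\<forall>\<^sub>F m in sequentially. norm (1 / (real (Suc m) * (\<bar>real N - real (Suc m)\<bar> + 1))) \<le> (real N + 1) * (1 / (real m + 1) ^ 2)"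
    by auto
qed

text \<open>With \<open>x = 1 / (m + 1)\<close> and \<open>y = 1 / (\<bar>N - m - 1\<bar> + 1)\<close> one has \<open>min x y \<le> 2 / N\<close>, hence
  \<open>x y \<le> (2 / N)\<^sup>1\<^sup>/\<^sup>4 (x\<^sup>3\<^sup>/\<^sup>2 + y\<^sup>3\<^sup>/\<^sup>2)\<close>, and both powers have bounded sums.\<close>

lemma harmonic_convolution_bound:
  assumes "N > 0"
  shows "(\<Sum>m. 1 / (real (Suc m) * (\<bar>real N - real (Suc m)\<bar> + 1)))
    \<le> 3 * (\<Sum>m. real (Suc m) powr (-3/2)) * (2 / real N) powr (1/4)"
proof -
  let ?g = "\<lambda>m. real (Suc m) powr (-3/2)"
  let ?y = "\<lambda>m. 1 / (\<bar>real N - real (Suc m)\<bar> + 1)"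
  let ?Z = "\<Sum>m. ?g m"
  have g: "summable ?g"
    using summable_real_powr_iff[of "-3/2"] summable_Suc_iff[of "\<lambda>m. real m powr (-3/2)"] by simp
  have part: "(\<Sum>m<M. 1 / (real (Suc m) * (\<bar>real N - real (Suc m)\<bar> + 1)))
      \<le> 3 * ?Z * (2 / real N) powr (1/4)" for M
  proof -
    have gs: "(\<Sum>m\<in>A. ?g m) \<le> ?Z" if "finite A" for A
      using sum_le_suminf[OF g that] by auto
    have summand: "1 / (real (Suc m) * (\<bar>real N - real (Suc m)\<bar> + 1))
        \<le> (2 / real N) powr (1/4) * (?g m + ?y m powr (3/2))" for m
    proof -
      define x where "x = 1 / real (Suc m)"
      define y where "y = ?y m"
      have xy: "0 < x" "x \<le> 1" "0 < y" "y \<le> 1" by (auto simp: x_def y_def)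
      have mn: "min x y \<le> 2 / real N"
      proof (cases "real (Suc m) \<ge> real N / 2")
        case True
        then have "x \<le> 2 / real N" using assms by (simp add: x_def field_simps)
        then show ?thesis by simp
      next
        case False
        then have "\<bar>real N - real (Suc m)\<bar> + 1 \<ge> real N / 2" by linarith
        then have "y \<le> 2 / real N" using assms by (simp add: y_def divide_simps split: if_splits)
        then show ?thesis by simp
      qed
      have "x * y = min x y * max x y" by (simp add: min_def max_def)
      also have "\<dots> \<le> 2 / real N * 1" using mn xy by (intro mult_mono) auto
      finally have "x * y \<le> 2 / real N" by simp
      \<comment> \<open>A quarter of the exponent pays for the decay in \<open>N\<close>; the other
        three quarters become 3/2, an exponent above 1, once the product is bounded by a sum of
        squares.\<close>
      moreover have "x * y = (x * y) powr (1/4) * (x * y) powr (3/4)"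
        using xy by (simp flip: powr_add)
      moreover have "(x * y) powr (3/4) \<le> x powr (3/2) + y powr (3/2)"
      proof -
        have "(x * y) powr (3/4) = x powr (3/4) * y powr (3/4)" using xy by (simp add: powr_mult)
        also have "\<dots> \<le> (x powr (3/4))\<^sup>2 + (y powr (3/4))\<^sup>2"
        proof -
          have "u * v \<le> u\<^sup>2 + v\<^sup>2" if "u \<ge> 0" "v \<ge> 0" for u v :: real
            using that sum_squares_bound[of u v] mult_nonneg_nonneg[OF that] by linarith
          then show ?thesis by simp
        qed
        also have "\<dots> = x powr (3/2) + y powr (3/2)"
          by (simp add: power2_eq_square flip: powr_add)
        finally show ?thesis .
      qed
      ultimately have "x * y \<le> (2 / real N) powr (1/4) * (x powr (3/2) + y powr (3/2))"
        using xy by (metis mult_mono less_eq_real_def mult_pos_pos powr_ge_zero powr_mono2 zero_le_divide_1_iff zero_le_numeral)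
      moreover have "x powr (3/2) = ?g m" by (simp add: x_def powr_divide powr_minus divide_simps)
      ultimately show ?thesis by (simp add: x_def y_def)
    qed
    \<comment> \<open>To the left of \<open>N\<close> the denominator is exactly
      \<open>N - m\<close>, to the right it is at least \<open>m - N + 1\<close>. Each side is thus
      bounded by a reindexed partial sum of \<open>?Z\<close>; with the sum over \<open>?g\<close>
      itself this makes the factor 3.\<close>
    have ysum: "(\<Sum>m<M. ?y m powr (3/2)) \<le> 2 * ?Z"
    proof -
      let ?A = "{m. m < M \<and> m < N}" and ?B = "{m. m < M \<and> \<not> m < N}"
      have "(\<Sum>m<M. ?y m powr (3/2)) = (\<Sum>m\<in>?A. ?y m powr (3/2)) + (\<Sum>m\<in>?B. ?y m powr (3/2))"
        by (subst sum.union_disjoint[symmetric]) (auto intro!: sum.cong)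
      also have "(\<Sum>m\<in>?A. ?y m powr (3/2)) = (\<Sum>m\<in>?A. ?g (N - Suc m))"
        by (intro sum.cong) (auto simp: powr_divide powr_minus divide_simps)
      also have "\<dots> = (\<Sum>m\<in>(\<lambda>m. N - Suc m) ` ?A. ?g m)"
        by (subst sum.reindex) (auto simp: inj_on_def)
      also have "\<dots> \<le> ?Z" by (rule gs) auto
      also have "(\<Sum>m\<in>?B. ?y m powr (3/2)) \<le> (\<Sum>m\<in>?B. ?g (m - N))"
      proof (rule sum_mono)
        fix m assume m: "m \<in> ?B"
        then have "\<bar>real N - real (Suc m)\<bar> + 1 \<ge> real (Suc (m - N))" by (simp add: of_nat_diff)
        then have "?y m \<le> 1 / real (Suc (m - N))" by (intro divide_left_mono) auto
        then have "?y m powr (3/2) \<le> (1 / real (Suc (m - N))) powr (3/2)" by (intro powr_mono2) auto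
        then show "?y m powr (3/2) \<le> ?g (m - N)" by (simp add: powr_divide powr_minus divide_simps)
      qed
      also have "\<dots> = (\<Sum>m\<in>(\<lambda>m. m - N) ` ?B. ?g m)"
        by (subst sum.reindex) (auto simp: inj_on_def)
      also have "\<dots> \<le> ?Z" by (rule gs) auto
      finally show ?thesis by simp
    qed
    have "(\<Sum>m<M. 1 / (real (Suc m) * (\<bar>real N - real (Suc m)\<bar> + 1)))
        \<le> (\<Sum>m<M. (2 / real N) powr (1/4) * (?g m + ?y m powr (3/2)))"
      by (intro sum_mono summand)
    also have "\<dots> = (2 / real N) powr (1/4) * ((\<Sum>m<M. ?g m) + (\<Sum>m<M. ?y m powr (3/2)))"
      by (simp only: sum_distrib_left[symmetric] sum.distrib)
    also have "\<dots> \<le> (2 / real N) powr (1/4) * (?Z + 2 * ?Z)"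
      using gs[of "{..<M}"] ysum by (intro mult_left_mono add_mono) auto
    finally show ?thesis by (simp add: mult_ac)
  qed
  show ?thesis by (rule suminf_le_const[OF harmonic_convolution_summable part])
qed

lemma harmonic_convolution_tendsto_0:
  "(\<lambda>N. \<Sum>m. 1 / (real (Suc m) * (\<bar>real N - real (Suc m)\<bar> + 1))) \<longlonglongrightarrow> 0"
proof (rule tendsto_sandwich)
  show "(\<lambda>N. 0) \<longlonglongrightarrow> (0::real)" by simp
  show "\<forall>\<^sub>F N in sequentially. 0 \<le> (\<Sum>m. 1 / (real (Suc m) * (\<bar>real N - real (Suc m)\<bar> + 1)))"
    by (intro always_eventually allI suminf_nonneg harmonic_convolution_summable) auto
  show "\<forall>\<^sub>F N in sequentially. (\<Sum>m. 1 / (real (Suc m) * (\<bar>real N - real (Suc m)\<bar> + 1)))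
      \<le> 3 * (\<Sum>m. real (Suc m) powr (-3/2)) * (2 / real N) powr (1/4)"
    using harmonic_convolution_bound by (auto simp: eventually_at_top_linorder intro!: exI[of _ 1])
  have "(\<lambda>N. (2 / real N) powr (1/4)) \<longlonglongrightarrow> 0" by real_asymp
  from tendsto_mult[OF tendsto_const this]
  show "(\<lambda>N. 3 * (\<Sum>m. real (Suc m) powr (-3/2)) * (2 / real N) powr (1/4)) \<longlonglongrightarrow> 0"
    by simp
qed

section \<open>Summation over all nonzero integers\<close>

lemma sum_reverse_tail:
  fixes h :: "nat \<Rightarrow> real"
  assumes "K \<le> M"
  shows "(\<Sum>i<K. h (M - Suc i)) = (\<Sum>i<M. h i) - (\<Sum>i<M - K. h i)"
  using assms
proof (induction K)
  case (Suc K)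
  have "M - K = Suc (M - Suc K)" using Suc.prems by simp
  then show ?case using Suc by simp
qed simp

lemma sum_split_add:
  fixes h :: "nat \<Rightarrow> real"
  shows "(\<Sum>i<M + K. h i) = (\<Sum>i<M. h i) + (\<Sum>i<K. h (M + i))"
  by (induction K) (auto simp: add.assoc)

lemma odd_sum_shift_up:
  fixes a :: real
  assumes "a \<in> {1, -1}"
  shows "(\<Sum>i<K. a ^ i / (2 * real M + (2 * real i + 1)) ^ q)
    = a ^ M * ((\<Sum>i<M + K. a ^ i / (2 * real i + 1) ^ q) - (\<Sum>i<M. a ^ i / (2 * real i + 1) ^ q))"
proof -
  have aa: "a ^ M * a ^ M = 1" using assms by (auto simp flip: power_mult_distrib)
  have "a ^ M * (\<Sum>i<K. a ^ (M + i) / (2 * real (M + i) + 1) ^ q)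
      = (\<Sum>i<K. a ^ i / (2 * real M + (2 * real i + 1)) ^ q)"
    unfolding sum_distrib_left
  proof (intro sum.cong refl)
    fix i
    have "a ^ M * a ^ (M + i) = a ^ i" by (simp add: power_add aa flip: mult.assoc)
    moreover have "2 * real (M + i) + 1 = 2 * real M + (2 * real i + 1)" by simp
    ultimately show "a ^ M * (a ^ (M + i) / (2 * real (M + i) + 1) ^ q)
        = a ^ i / (2 * real M + (2 * real i + 1)) ^ q"
      by (simp only: times_divide_eq_right)
  qed
  then show ?thesis unfolding sum_split_add by simp
qed

text \<open>The odd numbers \<open>2 * i + 1 - 2 * M\<close> start at \<open>1 - 2 * M\<close>. A
  negative one equals \<open>- (2 * d + 1)\<close> with \<open>d = M - 1 - i\<close>, and the
  reflection costs \<open>a * (-1) ^ q\<close> besides the common factor \<open>a ^ M\<close>; the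
  positive ones restart the series from 1. The two branches record whether the truncation
  \<open>K\<close> gets past zero.\<close>

lemma odd_sum_shift_down:
  fixes a :: real
  assumes "a \<in> {1, -1}"
  shows "(\<Sum>i<K. a ^ i / (2 * real i + 1 - 2 * real M) ^ q)
    = a ^ M * (if M \<le> K
        then (\<Sum>i<K - M. a ^ i / (2 * real i + 1) ^ q) + a * (-1) ^ q * (\<Sum>i<M. a ^ i / (2 * real i + 1) ^ q)
        else a * (-1) ^ q * ((\<Sum>i<M. a ^ i / (2 * real i + 1) ^ q) - (\<Sum>i<M - K. a ^ i / (2 * real i + 1) ^ q)))"
proof -
  let ?g = "\<lambda>i. a ^ i / (2 * real i + 1) ^ q"
  have aa: "a ^ k * a ^ k = 1" for k using assms by (auto simp flip: power_mult_distrib)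
  have refl: "(\<Sum>i<L. a ^ i / (2 * real i + 1 - 2 * real M) ^ q)
      = a ^ M * (a * (-1) ^ q * ((\<Sum>i<M. ?g i) - (\<Sum>i<M - L. ?g i)))" if "L \<le> M" for L
  proof -
    have "a ^ i / (2 * real i + 1 - 2 * real M) ^ q = a ^ M * (a * (-1) ^ q * ?g (M - Suc i))" if "i < L" for i
    proof -
      define d where "d = M - Suc i"
      have M: "M = Suc i + d" using that \<open>L \<le> M\<close> by (simp add: d_def)
      have "2 * real i + 1 - 2 * real M = - (2 * real d + 1)" by (simp add: M)
      then have "(2 * real i + 1 - 2 * real M) ^ q = (-1) ^ q * (2 * real d + 1) ^ q"
        by (metis power_minus)
      moreover have "a ^ M * a * a ^ d = a ^ i"
        using aa[of d] aa[of 1] by (simp add: M power_add) (metis (no_types, opaque_lifting) mult.assoc mult.commute mult.right_neutral)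
      ultimately show ?thesis
        unfolding d_def[symmetric]
        by (simp add: divide_simps) (metis (no_types, lifting) minus_one_mult_self mult.assoc mult.commute mult.left_neutral)
    qed
    then have "(\<Sum>i<L. a ^ i / (2 * real i + 1 - 2 * real M) ^ q)
        = a ^ M * (a * (-1) ^ q * (\<Sum>i<L. ?g (M - Suc i)))"
      by (simp add: sum_distrib_left)
    then show ?thesis using sum_reverse_tail[OF that, of ?g] by simp
  qed
  show ?thesis
  proof (cases "M \<le> K")
    case False
    then show ?thesis using refl[of K] by simp
  next
    case True
    have "a ^ M * (\<Sum>i<K - M. ?g i) = (\<Sum>i<K - M. a ^ (M + i) / (2 * real (M + i) + 1 - 2 * real M) ^ q)"
      by (simp add: sum_distrib_left power_add)
    then show ?thesis
      using True refl[of M] sum_split_add[of "\<lambda>i. a ^ i / (2 * real i + 1 - 2 * real M) ^ q" M "K - M"]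
      by (simp add: algebra_simps)
  qed
qed

text \<open>\<open>R i\<close> stands for the sum over nonzero integers in which \<open>m\<close>
  and \<open>- m\<close> are paired; its value does not matter here. For fixed \<open>m\<close> the
  inner sum over \<open>l\<close> is \<open>c ^ m / m ^ p\<close> times the tail
  \<open>\<Gamma> - G m\<close>, since shifting by \<open>n * m\<close> odd numbers contributes
  \<open>a ^ (n * m)\<close>. The reflected half contributes another \<open>- G m\<close> and a
  multiple of \<open>\<Gamma>\<close>, whence the factor 2 and the product term.\<close>

lemma bilateral_sum_limit:
  fixes p q n :: nat and a b :: real
  assumes pqn: "p > 0" "q > 0" "n > 0"
    and b: "b \<in> {1, -1}"
    and a: "a = (-1) ^ (p + q - 1)"
    and cp: "a ^ n * b = 1 \<longrightarrow> p \<noteq> 1"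
    and aq: "a = 1 \<longrightarrow> q \<noteq> 1"
    and R: "\<And>i. (\<lambda>m. b ^ Suc m / real (Suc m) ^ p *
        (1 / (2 * real n * real (Suc m) + (2 * real i + 1)) ^ q
         + (-1) ^ p / (2 * real i + 1 - 2 * real n * real (Suc m)) ^ q)) sums R i"
  defines "G \<equiv> \<lambda>m. \<Sum>i<n * m. a ^ i / (2 * real i + 1) ^ q"
  defines "\<Gamma> \<equiv> Lerch a q (1/2) / 2 ^ q"
  defines "c \<equiv> a ^ n * b"
  shows "summable (\<lambda>m. c ^ Suc m / real (Suc m) ^ p * (\<Gamma> - G (Suc m)))"
    and "(\<lambda>N. \<Sum>i<n * N. a ^ i * R i) \<longlonglongrightarrow>
      2 * (\<Sum>m. c ^ Suc m / real (Suc m) ^ p * (\<Gamma> - G (Suc m)))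
      - (1 - (-1) ^ p) * \<Gamma> * (c * Lerch c p 1)"
proof -
  have a1: "a \<in> {1, -1}" using a by (auto simp: minus_one_power_iff)
  have c1: "c \<in> {1, -1}" using a1 b by (cases "even n") (auto simp: c_def)
  have refl_sign: "(-1) ^ p * (a * (-1) ^ q) = (-1 :: real)"
  proof -
    obtain k where k: "p + q = Suc k" using pqn by (cases "p + q") auto
    have "even (p + q) \<longleftrightarrow> odd k" by (simp only: k even_Suc)
    then have "(even p \<longleftrightarrow> even q) \<longleftrightarrow> odd k" by simp
    then show ?thesis using a k by (auto simp: minus_one_power_iff)
  qed
  have abs_c: "\<bar>c ^ k\<bar> = 1" for k using c1 by (auto simp: power_abs)
  have tail: "\<bar>\<Gamma> - G m\<bar> \<le> 2 / (real m + 1)" for m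
  proof -
    have "\<bar>\<Gamma> - G m\<bar> \<le> 2 / (real (n * m) + 1)"
      unfolding \<Gamma>_def G_def by (rule odd_series_tail(2)) (use a1 aq pqn in auto)
    also have "\<dots> \<le> 2 / (real m + 1)"
      using pqn(3) by (intro divide_left_mono) (auto simp del: of_nat_mult simp: Suc_le_eq)
    finally show ?thesis .
  qed
  let ?s = "\<lambda>m. c ^ Suc m / real (Suc m) ^ p"
  have s_le: "\<bar>?s m\<bar> \<le> 1 / real (Suc m)" for m
    using pqn(1) abs_c[of "Suc m"] by (simp add: abs_mult divide_simps del: power_Suc) (simp add: self_le_power)
  let ?S = "\<lambda>m. ?s m * (\<Gamma> - G (Suc m))"
  show S: "summable ?S"
  proof (rule summable_comparison_test_ev)
    show "summable (\<lambda>m. 2 * (1 / (real m + 1) ^ 2))"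
      by (intro summable_mult summable_inverse_shifted_power) auto
    have "norm (?S m) \<le> 2 * (1 / (real m + 1) ^ 2)" for m
    proof -
      have "norm (?S m) \<le> 1 / real (Suc m) * (2 / (real (Suc m) + 1))"
        unfolding real_norm_def abs_mult by (intro mult_mono s_le tail) auto
      also have "\<dots> \<le> 1 / real (Suc m) * (2 / real (Suc m))"
        by (intro mult_left_mono divide_left_mono) auto
      finally show ?thesis by (simp add: power2_eq_square add.commute)
    qed
    then show "\<forall>\<^sub>F m in sequentially. norm (?S m) \<le> 2 * (1 / (real m + 1) ^ 2)" by auto
  qed
  let ?e = "(1 - (-1) ^ p) * \<Gamma>"
  have c_sums: "?s sums (c * Lerch c p 1)"
    using sums_mult[OF Lerch_sums[of c p 1], of c] c1 pqn cp by (auto simp: c_def add.commute)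
  \<comment> \<open>The column of index \<open>m\<close>, cut at \<open>l < 2nN\<close>, compared
    with its limit. The product term is switched on only for \<open>m < N\<close>, exactly where the
    reflected range reaches past zero; for \<open>p = 1\<close> its sum over all \<open>m\<close>
    may converge only conditionally, so it is kept as a partial sum until the final limit.\<close>
  define err where "err = (\<lambda>N m. (\<Sum>i<n * N. a ^ i * (b ^ Suc m / real (Suc m) ^ p *
        (1 / (2 * real n * real (Suc m) + (2 * real i + 1)) ^ q
         + (-1) ^ p / (2 * real i + 1 - 2 * real n * real (Suc m)) ^ q)))
       - 2 * ?S m + ?e * (if m < N then ?s m else 0))"
  define Rem where "Rem = (\<lambda>N. (\<Sum>i<n * N. a ^ i * R i) - 2 * (\<Sum>m. ?S m) + ?e * (\<Sum>m<N. ?s m))"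
  have err_sums: "err N sums Rem N" for N
  proof -
    have "(\<lambda>m. if m < N then ?s m else 0) sums (\<Sum>m<N. ?s m)"
      using sums_If_finite_set[of "{..<N}" ?s] by simp
    then show ?thesis
      unfolding err_def Rem_def
      by (intro sums_add sums_diff sums_sum sums_mult R summable_sums S)
  qed
  have err_bound: "\<bar>err N m\<bar> \<le> 4 * (1 / (real (Suc m) * (\<bar>real N - real (Suc m)\<bar> + 1)))" for N m
  proof -
    let ?m = "Suc m"
    have up: "(\<Sum>i<n * N. a ^ i / (2 * real n * real ?m + (2 * real i + 1)) ^ q)
        = a ^ (n * ?m) * (G (?m + N) - G ?m)"
      using odd_sum_shift_up[OF a1, of "n * ?m" q "n * N"] unfolding G_def of_nat_mult
      by (simp only: distrib_left mult.assoc)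
    have down: "(-1) ^ p * (\<Sum>i<n * N. a ^ i / (2 * real i + 1 - 2 * real n * real ?m) ^ q)
        = a ^ (n * ?m) * (if ?m \<le> N then (-1) ^ p * G (N - ?m) - G ?m else G (?m - N) - G ?m)"
    proof -
      have "(-1) ^ p * (\<Sum>i<n * N. a ^ i / (2 * real i + 1 - 2 * real n * real ?m) ^ q)
        = a ^ (n * ?m) * (if n * ?m \<le> n * N then (-1) ^ p * G (N - ?m) + (-1) ^ p * (a * (-1) ^ q) * G ?m
           else (-1) ^ p * (a * (-1) ^ q) * (G ?m - G (?m - N)))"
        using odd_sum_shift_down[OF a1, of "n * ?m" q "n * N"] unfolding G_def of_nat_mult
        by (simp only: mult.assoc diff_mult_distrib2 split: if_split) (simp only: algebra_simps, simp)
      moreover have "n * ?m \<le> n * N \<longleftrightarrow> ?m \<le> N" using pqn(3) by (simp del: mult_Suc_right)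
      ultimately show ?thesis unfolding refl_sign by (simp only:) simp
    qed
    have "(\<Sum>i<n * N. a ^ i * (b ^ ?m / real ?m ^ p *
        (1 / (2 * real n * real ?m + (2 * real i + 1)) ^ q
         + (-1) ^ p / (2 * real i + 1 - 2 * real n * real ?m) ^ q)))
       = b ^ ?m / real ?m ^ p * ((\<Sum>i<n * N. a ^ i / (2 * real n * real ?m + (2 * real i + 1)) ^ q)
          + (-1) ^ p * (\<Sum>i<n * N. a ^ i / (2 * real i + 1 - 2 * real n * real ?m) ^ q))"
      unfolding sum_distrib_left sum.distrib[symmetric]
      by (intro sum.cong refl) (simp add: algebra_simps del: of_nat_Suc power_Suc)
    also have "\<dots> = ?s m * (G (?m + N) - G ?m + (if ?m \<le> N then (-1) ^ p * G (N - ?m) - G ?m else G (?m - N) - G ?m))"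
      unfolding up down c_def by (simp only: power_mult_distrib power_mult) (simp add: algebra_simps del: of_nat_Suc power_Suc)
    finally have E: "(\<Sum>i<n * N. a ^ i * (b ^ ?m / real ?m ^ p *
        (1 / (2 * real n * real ?m + (2 * real i + 1)) ^ q
         + (-1) ^ p / (2 * real i + 1 - 2 * real n * real ?m) ^ q)))
       = ?s m * (G (?m + N) - G ?m + (if ?m \<le> N then (-1) ^ p * G (N - ?m) - G ?m else G (?m - N) - G ?m))" .
    \<comment> \<open>All occurrences of \<open>G ?m\<close> cancel. Two tails remain, at
      \<open>?m + N\<close> and at \<open>\<bar>N - ?m\<bar>\<close>, each bounded by
      \<open>2 / (\<bar>N - ?m\<bar> + 1)\<close>; together they give the constant 4.\<close>
    have "err N m = ?s m * (if ?m \<le> N then (G (?m + N) - \<Gamma>) + (-1) ^ p * (G (N - ?m) - \<Gamma>)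
        else (G (?m + N) - \<Gamma>) + (G (?m - N) - \<Gamma>))"
      unfolding err_def E by (cases "m < N") (simp_all add: Suc_le_eq algebra_simps diff_divide_distrib add_divide_distrib del: of_nat_Suc power_Suc)
    then have "\<bar>err N m\<bar> = \<bar>?s m\<bar> * \<bar>if ?m \<le> N then (G (?m + N) - \<Gamma>) + (-1) ^ p * (G (N - ?m) - \<Gamma>)
        else (G (?m + N) - \<Gamma>) + (G (?m - N) - \<Gamma>)\<bar>" by (simp only: abs_mult)
    also have "\<dots> \<le> 1 / real ?m * (4 / (\<bar>real N - real ?m\<bar> + 1))"
    proof (rule mult_mono[OF s_le])
      let ?d = "\<bar>real N - real ?m\<bar>"
      have 1: "\<bar>G (?m + N) - \<Gamma>\<bar> \<le> 2 / (?d + 1)"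
      proof -
        have "\<bar>G (?m + N) - \<Gamma>\<bar> \<le> 2 / (real (?m + N) + 1)" using tail[of "?m + N"] by linarith
        also have "\<dots> \<le> 2 / (?d + 1)" by (intro divide_left_mono) auto
        finally show ?thesis .
      qed
      have 2: "\<bar>(-1) ^ p * (G (N - ?m) - \<Gamma>)\<bar> \<le> 2 / (?d + 1)" if "?m \<le> N"
        using tail[of "N - ?m"] that by (simp add: abs_mult of_nat_diff)
      have 3: "\<bar>G (?m - N) - \<Gamma>\<bar> \<le> 2 / (?d + 1)" if "\<not> ?m \<le> N"
        using tail[of "?m - N"] that by (simp add: of_nat_diff)
      show "\<bar>if ?m \<le> N then (G (?m + N) - \<Gamma>) + (-1) ^ p * (G (N - ?m) - \<Gamma>)
        else (G (?m + N) - \<Gamma>) + (G (?m - N) - \<Gamma>)\<bar> \<le> 4 / (?d + 1)"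
        using 1 2 3 by (smt (verit) add_divide_distrib)
    qed auto
    finally show ?thesis by simp
  qed
  have "Rem \<longlonglongrightarrow> 0"
  proof (rule Lim_null_comparison)
    have "norm (Rem N) \<le> 4 * (\<Sum>m. 1 / (real (Suc m) * (\<bar>real N - real (Suc m)\<bar> + 1)))" for N
    proof -
      have "norm (\<Sum>m. err N m) \<le> (\<Sum>m. 4 * (1 / (real (Suc m) * (\<bar>real N - real (Suc m)\<bar> + 1))))"
        by (rule norm_suminf_le) (use err_bound in \<open>auto intro: summable_mult[OF harmonic_convolution_summable] simp only: real_norm_def\<close>)
      then show ?thesis
        using sums_unique[OF err_sums[of N]] suminf_mult[OF harmonic_convolution_summable[of N], of 4] by simp
    qed
    then show "\<forall>\<^sub>F N in sequentially. norm (Rem N) \<le> 4 * (\<Sum>m. 1 / (real (Suc m) * (\<bar>real N - real (Suc m)\<bar> + 1)))"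
      by auto
    show "(\<lambda>N. 4 * (\<Sum>m. 1 / (real (Suc m) * (\<bar>real N - real (Suc m)\<bar> + 1)))) \<longlonglongrightarrow> 0"
      using tendsto_mult[OF tendsto_const harmonic_convolution_tendsto_0, of 4] by simp
  qed
  moreover have "(\<lambda>N. \<Sum>m<N. ?s m) \<longlonglongrightarrow> c * Lerch c p 1" using c_sums by (simp add: sums_def)
  ultimately have "(\<lambda>N. Rem N + 2 * (\<Sum>m. ?S m) - ?e * (\<Sum>m<N. ?s m))
      \<longlonglongrightarrow> 0 + 2 * (\<Sum>m. ?S m) - ?e * (c * Lerch c p 1)"
    by (intro tendsto_intros)
  then show "(\<lambda>N. \<Sum>i<n * N. a ^ i * R i) \<longlonglongrightarrow> 2 * (\<Sum>m. ?S m) - ?e * (c * Lerch c p 1)"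
    by (simp add: Rem_def)
qed

section \<open>Partial fractions\<close>

text \<open>For \<open>u = - 1 / x\<close>, \<open>v = 1 / (x + l)\<close> and
  \<open>w = 1 / l\<close> the hypothesis is the elementary partial fraction identity. Used once, it
  lowers the total degree \<open>p + q\<close> by one at the price of a factor \<open>w\<close>, and
  Pascal's rule assembles the coefficients. Keeping only the algebraic relation lets the same
  identity serve \<open>1 / x\<close> and \<open>1 / (l - x)\<close>.\<close>

lemma partial_fraction_powers:
  fixes u v w :: real
  assumes uvw: "u * v = w * (u + v)" and pq: "p + q > 0"
  shows "u ^ p * v ^ q = (\<Sum>j<p. real ((q + j - 1) choose j) * w ^ (q + j) * u ^ (p - j))
    + (\<Sum>j<q. real ((p + j - 1) choose j) * w ^ (p + j) * v ^ (q - j))"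
proof -
  define A where "A = (\<lambda>u p q. \<Sum>j<p. real ((q + j - 1) choose j) * w ^ (q + j) * u ^ (p - j))"
  \<comment> \<open>With truncated subtraction \<open>(0 + j - 1) choose j\<close> is 1 at
    \<open>j = 0\<close> and 0 beyond, so the formula stays correct on the boundary of the
    induction.\<close>
  have A_q0: "A u p 0 = (if p = 0 then 0 else u ^ p)" for u p
  proof (cases p)
    case (Suc r)
    have "A u (Suc r) 0 = u ^ Suc r + (\<Sum>j<r. real ((0 + Suc j - 1) choose Suc j) * w ^ (0 + Suc j) * u ^ (Suc r - Suc j))"
      unfolding A_def by (subst sum.lessThan_Suc_shift) simp
    then show ?thesis using Suc by (simp add: binomial_eq_0)
  qed (simp add: A_def)
  have A_p0: "A u 0 q = 0" for u q by (simp add: A_def)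
  have rec: "A u (Suc p) (Suc q) = w * (A u p (Suc q) + A u (Suc p) q)" for u p q
  proof -
    have "A u (Suc p) (Suc q) = w ^ Suc q * u ^ Suc p
        + (\<Sum>j<p. real (Suc (q + j) choose Suc j) * w ^ (Suc q + Suc j) * u ^ (p - j))"
      unfolding A_def by (subst sum.lessThan_Suc_shift) simp
    also have "(\<Sum>j<p. real (Suc (q + j) choose Suc j) * w ^ (Suc q + Suc j) * u ^ (p - j))
      = w * A u p (Suc q) + w * (\<Sum>j<p. real ((q + Suc j - 1) choose Suc j) * w ^ (q + Suc j) * u ^ (Suc p - Suc j))"
      unfolding A_def sum_distrib_left sum.distrib[symmetric]
      by (intro sum.cong refl) (simp add: algebra_simps)
    also have "w ^ Suc q * u ^ Suc p + (w * A u p (Suc q) + w * (\<Sum>j<p. real ((q + Suc j - 1) choose Suc j) * w ^ (q + Suc j) * u ^ (Suc p - Suc j)))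
      = w * (A u p (Suc q) + A u (Suc p) q)"
    proof -
      have "A u (Suc p) q = w ^ q * u ^ Suc p
          + (\<Sum>j<p. real ((q + Suc j - 1) choose Suc j) * w ^ (q + Suc j) * u ^ (Suc p - Suc j))"
        unfolding A_def by (subst sum.lessThan_Suc_shift) simp
      then show ?thesis by (simp add: algebra_simps)
    qed
    finally show ?thesis .
  qed
  have "u ^ p * v ^ q = A u p q + A v q p"
    using pq
  proof (induction "p + q" arbitrary: p q)
    case (Suc r)
    show ?case
    proof (cases "p = 0 \<or> q = 0")
      case True
      then show ?thesis using Suc.prems by (auto simp: A_q0 A_p0)
    next
      case False
      then obtain p' q' where pq': "p = Suc p'" "q = Suc q'" by (metis not0_implies_Suc)
      have "u ^ p * v ^ q = (u * v) * (u ^ p' * v ^ q')" by (simp add: pq')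
      also have "\<dots> = w * (u ^ Suc p' * v ^ q' + u ^ p' * v ^ Suc q')"
        unfolding uvw by (simp add: algebra_simps)
      also have "u ^ Suc p' * v ^ q' = A u (Suc p') q' + A v q' (Suc p')"
        by (rule Suc(1)) (use Suc(2) pq' in auto)
      also have "u ^ p' * v ^ Suc q' = A u p' (Suc q') + A v (Suc q') p'"
        by (rule Suc(1)) (use Suc(2) pq' in auto)
      finally show ?thesis unfolding pq' rec by (simp add: algebra_simps)
    qed
  qed simp
  then show ?thesis by (simp add: A_def)
qed

section \<open>Cotangent expansion and bilateral sums for Theta\<close>

lemma Gamma_reflection_real:
  fixes x :: real
  assumes "0 < x" "x < 1"
  shows "Gamma x * Gamma (1 - x) = pi / sin (pi * x)"
proof -
  have "complex_of_real (Gamma x * Gamma (1 - x)) = of_real (pi / sin (pi * x))"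
    using Gamma_reflection_complex[of "of_real x"]
    by (simp add: Gamma_complex_of_real[symmetric] sin_of_real[symmetric] del: Gamma_complex_of_real sin_of_real)
  then show ?thesis by (simp only: of_real_eq_iff)
qed

text \<open>Differentiate \<open>Gamma t * Gamma (1 - t)\<close> once by the product rule and once
  as \<open>pi / sin (pi * t)\<close>, then divide by the common value.\<close>

lemma Digamma_reflection_real:
  fixes x :: real
  assumes "0 < x" "x < 1"
  shows "Digamma (1 - x) - Digamma x = pi * cot (pi * x)"
proof -
  have npos: "t \<notin> \<int>\<^sub>\<le>\<^sub>0" if "t > 0" for t :: real using that by (auto elim!: nonpos_Ints_cases)
  have s: "sin (pi * x) > 0" using assms by (intro sin_gt_zero) auto
  have d1: "((\<lambda>t. Gamma t * Gamma (1 - t)) has_real_derivative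
      Gamma x * Gamma (1 - x) * (Digamma x - Digamma (1 - x))) (at x)"
    using assms npos[of x] npos[of "1 - x"] by (auto intro!: derivative_eq_intros simp: algebra_simps)
  have d2: "((\<lambda>t. Gamma t * Gamma (1 - t)) has_real_derivative
      - (pi * pi * cos (pi * x) / (sin (pi * x))\<^sup>2)) (at x)"
  proof (rule has_field_derivative_transform_within_open[of "\<lambda>t. pi / sin (pi * t)" _ _ "{0<..<1}"])
    show "((\<lambda>t. pi / sin (pi * t)) has_real_derivative - (pi * pi * cos (pi * x) / (sin (pi * x))\<^sup>2)) (at x)"
      using s by (auto intro!: derivative_eq_intros simp: power2_eq_square)
  qed (use assms Gamma_reflection_real in auto)
  have "pi / sin (pi * x) * (Digamma x - Digamma (1 - x)) = - (pi * pi * cos (pi * x) / (sin (pi * x))\<^sup>2)"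
    using DERIV_unique[OF d1 d2] Gamma_reflection_real[OF assms] by simp
  then have "(pi / sin (pi * x) * (Digamma x - Digamma (1 - x))) * ((sin (pi * x))\<^sup>2 / pi)
      = - (pi * pi * cos (pi * x) / (sin (pi * x))\<^sup>2) * ((sin (pi * x))\<^sup>2 / pi)"
    by (simp only:)
  then have "sin (pi * x) * (Digamma (1 - x) - Digamma x) = pi * cos (pi * x)"
    using s by (simp add: power2_eq_square algebra_simps)
  then show ?thesis using s by (simp add: cot_def field_simps)
qed

text \<open>The \<open>ln M\<close> in the two limits defining the Digamma values cancel. This
  series is what \<open>Theta 1 1\<close> stands for, although neither of its halves converges
  alone.\<close>

lemma cot_partial_fraction:
  assumes "0 < x" "x < 1"
  shows "(\<lambda>m. 1 / (real m + x) - 1 / (real m + (1 - x))) sums (pi * cot (pi * x))"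
proof -
  have "(\<lambda>M. (of_real (ln (real M)) - (\<Sum>m<M. inverse ((1 - x) + of_nat m)))
      - (of_real (ln (real M)) - (\<Sum>m<M. inverse (x + of_nat m)))) \<longlonglongrightarrow> Digamma (1 - x) - Digamma x"
    by (intro tendsto_diff Digamma_LIMSEQ) (use assms in auto)
  then show ?thesis
    unfolding sums_def Digamma_reflection_real[OF assms]
    by (simp add: sum_subtractf divide_inverse add_ac)
qed

text \<open>The residue classes are met in increasing order in the series but in decreasing order in
  the final formula; this sign is the price of the reversal.\<close>

lemma Theta_reflect:
  assumes "b \<in> {1, -1}" "0 < r"
  shows "Theta b k (r - s) r = b * (-1) ^ k * Theta b k s r"
proof (cases "b = 1 \<and> k = 1")
  case True
  have "pi * (r - s) / r = - (pi * s / r) + pi" using assms by (simp add: field_simps)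
  then have "cot (pi * (r - s) / r) = - cot (pi * s / r)" by (simp add: cot_def)
  with True show ?thesis by (simp add: Theta_def)
next
  case False
  have "b * b = 1" using assms by auto
  then show ?thesis using False
    using assms by (cases "even k") (auto simp: Theta_def)
qed

lemma inverse_shift_power_tendsto_0:
  fixes b :: real
  assumes "k > 0" "b \<in> {1, -1}"
  shows "(\<lambda>m. b ^ m / (real m + \<tau>) ^ k) \<longlonglongrightarrow> 0"
proof (rule Lim_null_comparison)
  have "filterlim (\<lambda>m. \<bar>real m + \<tau>\<bar> ^ k) at_top sequentially"
  proof (intro filterlim_pow_at_top)
    have "filterlim (\<lambda>m. real m + \<tau>) at_top sequentially" by real_asymp
    then show "filterlim (\<lambda>m. \<bar>real m + \<tau>\<bar>) at_top sequentially"
      by (rule filterlim_at_top_mono) (intro always_eventually allI abs_ge_self)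
  qed (use assms in auto)
  then show "(\<lambda>m. 1 / \<bar>real m + \<tau>\<bar> ^ k) \<longlonglongrightarrow> 0"
    by (intro tendsto_divide_0[OF tendsto_const] filterlim_at_top_imp_at_infinity)
  show "\<forall>\<^sub>F m in sequentially. norm (b ^ m / (real m + \<tau>) ^ k) \<le> 1 / \<bar>real m + \<tau>\<bar> ^ k"
    using assms by (auto simp: power_abs)
qed

text \<open>The sum of \<open>b ^ m / (m + \<tau>) ^ k\<close> over all integers, taken
  symmetrically, is multiplied by \<open>b\<close> when \<open>\<tau>\<close> grows by 1, and for
  \<open>\<tau> = \<sigma>\<close> it is the Theta value. The subtracted power is the omitted term
  \<open>m = 0\<close>. For \<open>k = 1\<close> convergence is only conditional, so the shift is
  done one step at a time with explicit boundary terms.\<close>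

lemma Theta_bilateral_sums:
  assumes b: "b \<in> {1, -1}" and k: "k > 0" and \<sigma>: "0 < \<sigma>" "\<sigma> < 1" and rs: "\<sigma> = s / r" "r > 0"
  shows "(\<lambda>m. b ^ Suc m * (1 / (real (Suc m) + (\<sigma> + real i)) ^ k + 1 / (\<sigma> + real i - real (Suc m)) ^ k))
    sums (b ^ i * Theta b k s r - 1 / (\<sigma> + real i) ^ k)"
proof (induction i)
  case 0
  let ?f = "\<lambda>m. b ^ m / (real m + \<sigma>) ^ k" and ?g = "\<lambda>m. b * (-1) ^ k * (b ^ m / (real m + (1 - \<sigma>)) ^ k)"
  have lim: "(\<lambda>m. ?f m + ?g m) sums Theta b k s r"
  proof (cases "b = 1 \<and> k = 1")
    case True
    then show ?thesis using cot_partial_fraction[OF \<sigma>] by (simp add: Theta_def rs)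
  next
    case False
    have "(r - s) / r = 1 - \<sigma>" using rs by (simp add: field_simps)
    then have "Theta b k s r = Lerch b k \<sigma> + b * (-1) ^ k * Lerch b k (1 - \<sigma>)"
      unfolding Theta_def if_not_P[OF False] by (simp add: rs)
    moreover have "(\<lambda>m. ?f m + ?g m) sums (Lerch b k \<sigma> + b * (-1) ^ k * Lerch b k (1 - \<sigma>))"
      by (intro sums_add sums_mult Lerch_sums) (use False b k \<sigma> in auto)
    ultimately show ?thesis by (simp only:)
  qed
  \<comment> \<open>\<open>Theta\<close> pairs the integer \<open>m\<close> with
    \<open>- (m + 1)\<close>, whereas here \<open>m + 1\<close> is paired with
    \<open>- (m + 1)\<close>. A telescoping series moves one half by a step and removes its initial
    term.\<close>
  have "?f \<longlonglongrightarrow> 0" by (rule inverse_shift_power_tendsto_0) (use b k in auto)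
  then have "(\<lambda>m. ?f (Suc m) - ?f m) sums (0 - ?f 0)" by (rule telescope_sums)
  from sums_add[OF lim this]
  have X: "(\<lambda>m. ?f (Suc m) + ?g m) sums (Theta b k s r - 1 / \<sigma> ^ k)" by (simp add: add_ac)
  have "?f (Suc m) + ?g m = b ^ Suc m * (1 / (real (Suc m) + (\<sigma> + real 0)) ^ k + 1 / (\<sigma> + real 0 - real (Suc m)) ^ k)" for m
  proof -
    have "(\<sigma> - real (Suc m)) ^ k = (-1) ^ k * (real m + (1 - \<sigma>)) ^ k"
      by (simp add: algebra_simps flip: power_mult_distrib)
    then show ?thesis by (cases "even k") (simp_all add: algebra_simps)
  qed
  then have "(\<lambda>m. ?f (Suc m) + ?g m) = (\<lambda>m. b ^ Suc m * (1 / (real (Suc m) + (\<sigma> + real 0)) ^ k + 1 / (\<sigma> + real 0 - real (Suc m)) ^ k))"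
    by (rule ext)
  from X[unfolded this] show ?case by simp
next
  case (Suc i)
  define \<tau> where "\<tau> = \<sigma> + real i"
  have bb: "b * b = 1" using b by auto
  let ?f = "\<lambda>\<tau> m. b ^ Suc m * (1 / (real (Suc m) + \<tau>) ^ k + 1 / (\<tau> - real (Suc m)) ^ k)"
  let ?h = "\<lambda>m. b ^ m / (real m + (1 + \<tau>)) ^ k" and ?g = "\<lambda>m. b ^ Suc m / (\<tau> - real m) ^ k"
  have "?h \<longlonglongrightarrow> 0" by (rule inverse_shift_power_tendsto_0) (use b k in auto)
  then have 1: "(\<lambda>m. ?h (Suc m) - ?h m) sums (0 - ?h 0)" by (rule telescope_sums)
  have "(\<lambda>m. b * (-1) ^ k * (b ^ m / (real m + (- \<tau>)) ^ k)) \<longlonglongrightarrow> b * (-1) ^ k * 0"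
    by (intro tendsto_mult tendsto_const inverse_shift_power_tendsto_0) (use b k in auto)
  moreover have "b * (-1) ^ k * (b ^ m / (real m + (- \<tau>)) ^ k) = ?g m" for m
  proof -
    have "(\<tau> - real m) ^ k = (-1) ^ k * (real m + (- \<tau>)) ^ k"
      by (simp flip: power_mult_distrib)
    then show ?thesis by (cases "even k") simp_all
  qed
  ultimately have "?g \<longlonglongrightarrow> 0" by simp
  then have 2: "(\<lambda>m. ?g m - ?g (Suc m)) sums (?g 0 - 0)" by (rule telescope_sums')
  \<comment> \<open>Moving \<open>\<tau>\<close> by 1 slides the symmetric window of integers by one
    place; the entering and the leaving term appear as the telescoping differences of
    \<open>?h\<close> and \<open>?g\<close>.\<close>
  have "?f (\<tau> + 1) m = b * ?f \<tau> m + ((?h (Suc m) - ?h m) + (?g m - ?g (Suc m)))" for m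
  proof -
    have *: "b * b ^ Suc m = b ^ m" using bb by (simp flip: mult.assoc)
    have "real (Suc m) + (\<tau> + 1) = real (Suc m) + (1 + \<tau>)" "real m + (1 + \<tau>) = real (Suc m) + \<tau>"
      "\<tau> + 1 - real (Suc m) = \<tau> - real m" by auto
    then show ?thesis
      using * by (simp only: distrib_left mult.assoc[symmetric] power_Suc[of b "Suc m"]) (simp add: algebra_simps)
  qed
  moreover have "(\<lambda>m. b * ?f \<tau> m + ((?h (Suc m) - ?h m) + (?g m - ?g (Suc m))))
    sums (b * (b ^ i * Theta b k s r - 1 / \<tau> ^ k) + ((0 - ?h 0) + (?g 0 - 0)))"
    by (intro sums_add sums_mult 1 2) (use Suc in \<open>simp add: \<tau>_def\<close>)
  ultimately have "?f (\<tau> + 1) sums (b * (b ^ i * Theta b k s r - 1 / \<tau> ^ k) + ((0 - ?h 0) + (?g 0 - 0)))"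
    by simp
  moreover have "b * (b ^ i * Theta b k s r - 1 / \<tau> ^ k) + ((0 - ?h 0) + (?g 0 - 0))
      = b ^ Suc i * Theta b k s r - 1 / (\<sigma> + real (Suc i)) ^ k"
    by (simp add: \<tau>_def algebra_simps)
  moreover have "\<tau> + 1 = \<sigma> + real (Suc i)" by (simp add: \<tau>_def)
  ultimately show ?case by simp
qed

section \<open>Evaluation of the inner sums and of the double series\<close>

lemma power_sum_bilateral_sums:
  assumes b: "b \<in> {1, -1}" and n: "n > (0::nat)" and r: "r > 0"
  shows "(\<lambda>m. b ^ Suc m * ((- 1 / (2 * real n * real (Suc m))) ^ r + (1 / (2 * real n * real (Suc m))) ^ r))
    sums (if even r then 2 * b * Lerch b r 1 / (2 * real n) ^ r else 0)"
proof (cases "even r")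
  case True
  have "(\<lambda>m. 2 * b / (2 * real n) ^ r * (b ^ m / (real m + 1) ^ r)) sums (2 * b / (2 * real n) ^ r * Lerch b r 1)"
    by (intro sums_mult Lerch_sums) (use b r True in auto)
  moreover have "b ^ Suc m * ((- 1 / (2 * real n * real (Suc m))) ^ r + (1 / (2 * real n * real (Suc m))) ^ r)
      = 2 * b / (2 * real n) ^ r * (b ^ m / (real m + 1) ^ r)" for m
  proof -
    define X where "X = 2 * real n"
    show ?thesis
      using True unfolding X_def[symmetric] by (simp add: power_divide power_mult_distrib mult_ac add.commute)
  qed
  ultimately show ?thesis using True by simp
next
  case False
  have "(- 1 / (2 * real n * real (Suc m))) ^ r + (1 / (2 * real n * real (Suc m))) ^ r = 0" for m
    using False by (simp add: power_divide)
  then show ?thesis using False by simp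
qed

text \<open>Here \<open>l / (2 * n) = \<sigma> + i\<close> with
  \<open>\<sigma> = (2 * j + 1) / (2 * n)\<close> between 0 and 1, so the residue class
  \<open>j\<close> determines the Theta value and the quotient \<open>i\<close> only the sign
  \<open>b ^ i\<close>. The integers \<open>m\<close> and \<open>- m\<close> are two instances of
  one partial fraction identity, in \<open>u\<close>, \<open>v\<close> and in \<open>u'\<close>,
  \<open>v'\<close>; writing \<open>1 / m\<close> through \<open>u\<close> produces
  \<open>(- 2 * n) ^ p\<close>.\<close>

lemma bilateral_inner_sums:
  fixes p q n i j :: nat and b :: real
  assumes p: "p > 0" and q: "q > 0" and jn: "j < n" and b: "b \<in> {1, -1}"
  defines "l \<equiv> 2 * real (n * i + j) + 1"
  shows "(\<lambda>m. b ^ Suc m / real (Suc m) ^ p *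
        (1 / (2 * real n * real (Suc m) + l) ^ q + (-1) ^ p / (l - 2 * real n * real (Suc m)) ^ q)) sums
    ((- 2 * real n) ^ p *
      ((\<Sum>k = 0..p div 2. real ((p + q - 2 * k - 1) choose (q - 1)) * (2 * b * Lerch b (2 * k) 1 / (2 * real n) ^ (2 * k)) / l ^ (p + q - 2 * k))
      + (\<Sum>k = 1..q. real ((p + q - k - 1) choose (p - 1)) * (b ^ i * Theta b k (2 * real j + 1) (2 * real n) / (2 * real n) ^ k) / l ^ (p + q - k))))"
    (is "?T sums _")
proof -
  have n: "n > 0" using jn by simp
  have l: "l > 0" by (simp add: l_def add_nonneg_pos)
  define w where "w = 1 / l"
  define u where "u = (\<lambda>m. - 1 / (2 * real n * real (Suc m)))"
  define u' where "u' = (\<lambda>m. 1 / (2 * real n * real (Suc m)))"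
  define v where "v = (\<lambda>m. 1 / (2 * real n * real (Suc m) + l))"
  define v' where "v' = (\<lambda>m. 1 / (l - 2 * real n * real (Suc m)))"
  define U where "U = (\<lambda>r. if even r then 2 * b * Lerch b r 1 / (2 * real n) ^ r else 0)"
  \<comment> \<open>The subtracted \<open>w ^ r\<close> is the term \<open>m = 0\<close> missing
    from the Theta sum.\<close>
  define V where "V = (\<lambda>r. b ^ i * Theta b r (2 * real j + 1) (2 * real n) / (2 * real n) ^ r - w ^ r)"
  \<comment> \<open>An odd number is compared with an even one.\<close>
  have ne: "l - 2 * real n * real (Suc m) \<noteq> 0" for m
  proof
    assume "l - 2 * real n * real (Suc m) = 0"
    then have "real (2 * (n * i + j) + 1) = real (2 * (n * Suc m))"
      unfolding l_def by (simp only: of_nat_add of_nat_mult of_nat_1 of_nat_numeral)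
    then have "2 * (n * i + j) + 1 = 2 * (n * Suc m)" by (simp only: of_nat_eq_iff)
    then show False by presburger
  qed
  have X: "2 * real n * real (Suc m) > 0" for m using n by simp
  have uv: "u m * v m = w * (u m + v m)" for m
  proof -
    define x where "x = 2 * real n * real (Suc m)"
    have "x > 0" using X x_def by simp
    then have "- 1 / x * (1 / (x + l)) = 1 / l * (- 1 / x + 1 / (x + l))"
      using l by (simp add: divide_simps)
    then show ?thesis by (simp only: u_def v_def w_def x_def)
  qed
  have uv': "u' m * v' m = w * (u' m + v' m)" for m
  proof -
    define x where "x = 2 * real n * real (Suc m)"
    have "x > 0" "l - x \<noteq> 0" using X ne x_def by simp_all
    then have "1 / x * (1 / (l - x)) = 1 / l * (1 / x + 1 / (l - x))"
      using l by (simp add: divide_simps)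
    then show ?thesis by (simp only: u'_def v'_def w_def x_def)
  qed
  have U: "(\<lambda>m. b ^ Suc m * (u m ^ r + u' m ^ r)) sums U r" if "r > 0" for r
    unfolding u_def u'_def U_def using power_sum_bilateral_sums[OF b n that] .
  have V: "(\<lambda>m. b ^ Suc m * (v m ^ r + v' m ^ r)) sums V r" if "r > 0" for r
  proof -
    define \<sigma> where "\<sigma> = (2 * real j + 1) / (2 * real n)"
    have "real (Suc j) \<le> real n" using jn by (intro of_nat_mono) simp
    then have \<sigma>: "0 < \<sigma>" "\<sigma> < 1" using n by (auto simp: \<sigma>_def divide_simps)
    have l_eq: "l = 2 * real n * (\<sigma> + real i)" using n by (simp add: \<sigma>_def l_def field_simps)
    have "(\<lambda>m. b ^ Suc m * (1 / (real (Suc m) + (\<sigma> + real i)) ^ r + 1 / (\<sigma> + real i - real (Suc m)) ^ r) / (2 * real n) ^ r)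
      sums ((b ^ i * Theta b r (2 * real j + 1) (2 * real n) - 1 / (\<sigma> + real i) ^ r) / (2 * real n) ^ r)"
      by (intro sums_divide Theta_bilateral_sums) (use b that \<sigma> n in \<open>auto simp: \<sigma>_def\<close>)
    moreover have "b ^ Suc m * (1 / (real (Suc m) + (\<sigma> + real i)) ^ r + 1 / (\<sigma> + real i - real (Suc m)) ^ r) / (2 * real n) ^ r
        = b ^ Suc m * (v m ^ r + v' m ^ r)" for m
    proof -
      have "v m = 1 / ((real (Suc m) + (\<sigma> + real i)) * (2 * real n))"
        unfolding v_def l_eq by (simp add: algebra_simps)
      moreover have "v' m = 1 / ((\<sigma> + real i - real (Suc m)) * (2 * real n))"
        unfolding v'_def l_eq by (simp add: algebra_simps)
      ultimately show ?thesis
        by (simp add: power_divide power_mult_distrib add_divide_distrib distrib_left del: of_nat_Suc power_Suc)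
    qed
    moreover have "(b ^ i * Theta b r (2 * real j + 1) (2 * real n) - 1 / (\<sigma> + real i) ^ r) / (2 * real n) ^ r = V r"
      unfolding V_def w_def l_eq by (simp add: diff_divide_distrib power_divide power_mult_distrib)
    ultimately show ?thesis by simp
  qed
  have T: "?T m = (- 2 * real n) ^ p * ((\<Sum>k<p. real ((q + k - 1) choose k) * w ^ (q + k) * (b ^ Suc m * (u m ^ (p - k) + u' m ^ (p - k))))
      + (\<Sum>k<q. real ((p + k - 1) choose k) * w ^ (p + k) * (b ^ Suc m * (v m ^ (q - k) + v' m ^ (q - k)))))" for m
  proof -
    have pq: "p + q > 0" using p by simp
    have "- 2 * real n * u m = 1 / real (Suc m)" "- 2 * real n * u' m = - 1 / real (Suc m)"
      using n by (simp_all add: u_def u'_def divide_simps)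
    then have P: "(- 2 * real n) ^ p * u m ^ p = 1 / real (Suc m) ^ p" "(- 2 * real n) ^ p * u' m ^ p = (-1) ^ p / real (Suc m) ^ p"
      by (metis power_mult_distrib power_one_over, metis power_mult_distrib power_divide)
    have "?T m = b ^ Suc m * ((1 / real (Suc m) ^ p) * v m ^ q + ((-1) ^ p / real (Suc m) ^ p) * v' m ^ q)"
      unfolding v_def v'_def by (simp add: power_divide add_divide_distrib distrib_left mult_ac del: of_nat_Suc power_Suc)
    also have "\<dots> = (- 2 * real n) ^ p * (b ^ Suc m * (u m ^ p * v m ^ q + u' m ^ p * v' m ^ q))"
      unfolding P[symmetric] by (simp only: algebra_simps)
    finally have "?T m = (- 2 * real n) ^ p * (b ^ Suc m * (u m ^ p * v m ^ q + u' m ^ p * v' m ^ q))" .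
    then show ?thesis
      unfolding partial_fraction_powers[OF uv pq] partial_fraction_powers[OF uv' pq]
      by (simp add: distrib_left sum.distrib sum_distrib_left mult_ac del: power_Suc)
  qed
  have "?T sums ((- 2 * real n) ^ p * ((\<Sum>k<p. real ((q + k - 1) choose k) * w ^ (q + k) * U (p - k))
      + (\<Sum>k<q. real ((p + k - 1) choose k) * w ^ (p + k) * V (q - k))))"
    unfolding T by (intro sums_mult sums_add sums_sum U V) auto
  moreover have "(\<Sum>k<p. real ((q + k - 1) choose k) * w ^ (q + k) * U (p - k))
      = (\<Sum>r = 1..p. real ((p + q - r - 1) choose (q - 1)) * w ^ (p + q - r) * U r)"
  proof (rule sum.reindex_bij_witness[of _ "\<lambda>r. p - r" "\<lambda>k. p - k"])
    fix k assume "k \<in> {..<p}"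
    then have k: "k < p" by simp
    have "(q + k - 1) choose k = (q + k - 1) choose (q - 1)"
      using binomial_symmetric[of k "q + k - 1"] q by simp
    moreover have "p + q - (p - k) = q + k" using k by simp
    ultimately show "real (p + q - (p - k) - 1 choose (q - 1)) * w ^ (p + q - (p - k)) * U (p - k)
       = real (q + k - 1 choose k) * w ^ (q + k) * U (p - k)" by simp
  qed auto
  moreover have "(\<Sum>k<q. real ((p + k - 1) choose k) * w ^ (p + k) * V (q - k))
      = (\<Sum>k = 1..q. real ((p + q - k - 1) choose (p - 1)) * w ^ (p + q - k) * V k)"
  proof (rule sum.reindex_bij_witness[of _ "\<lambda>r. q - r" "\<lambda>k. q - k"])
    fix k assume "k \<in> {..<q}"
    then have k: "k < q" by simp
    have "(p + k - 1) choose k = (p + k - 1) choose (p - 1)"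
      using binomial_symmetric[of k "p + k - 1"] p by simp
    moreover have "p + q - (q - k) = p + k" using k by simp
    ultimately show "real (p + q - (q - k) - 1 choose (p - 1)) * w ^ (p + q - (q - k)) * V (q - k)
       = real (p + k - 1 choose k) * w ^ (p + k) * V (q - k)" by simp
  qed auto
  moreover have "(\<Sum>k = 1..q. real ((p + q - k - 1) choose (p - 1)) * w ^ (p + q - k) * V k)
      = (\<Sum>k = 1..q. real ((p + q - k - 1) choose (p - 1)) * (b ^ i * Theta b k (2 * real j + 1) (2 * real n) / (2 * real n) ^ k) / l ^ (p + q - k))
        - real ((p + q - 1) choose (q - 1)) * w ^ (p + q)"
  proof -
    \<comment> \<open>Every omitted term \<open>w ^ k\<close> meets the cofactor
      \<open>w ^ (p + q - k)\<close>, so all of them carry the same power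
      \<open>w ^ (p + q)\<close>; their coefficients collapse by the hockey-stick identity.\<close>
    have "(\<Sum>k = 1..q. (p + q - k - 1) choose (p - 1)) = (\<Sum>k\<le>q - 1. ((p - 1) + k) choose k)"
    proof (rule sum.reindex_bij_witness[of _ "\<lambda>k. q - k" "\<lambda>k. q - k"])
      fix k assume k: "k \<in> {1..q}"
      have "p - 1 + (q - k) choose (q - k) = p - 1 + (q - k) choose (p - 1)"
        using binomial_symmetric[of "q - k" "p - 1 + (q - k)"] by simp
      moreover have "p - 1 + (q - k) = p + q - k - 1" using k p by simp
      ultimately show "p - 1 + (q - k) choose (q - k) = p + q - k - 1 choose (p - 1)" by simp
    qed (use q in auto)
    also have "\<dots> = (p + q - 1) choose (q - 1)"
    proof -
      have "Suc (p - 1 + (q - 1)) = p + q - 1" using p q by simp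
      then show ?thesis unfolding sum_choose_lower by (simp only:)
    qed
    finally have "(\<Sum>k = 1..q. real ((p + q - k - 1) choose (p - 1))) = real ((p + q - 1) choose (q - 1))"
      by (metis of_nat_sum)
    moreover have "real ((p + q - k - 1) choose (p - 1)) * w ^ (p + q - k) * V k
      = real ((p + q - k - 1) choose (p - 1)) * (b ^ i * Theta b k (2 * real j + 1) (2 * real n) / (2 * real n) ^ k) / l ^ (p + q - k)
        - real ((p + q - k - 1) choose (p - 1)) * w ^ (p + q)" if "k \<in> {1..q}" for k
    proof -
      have "w ^ (p + q - k) * w ^ k = w ^ (p + q)" using that by (simp flip: power_add)
      then show ?thesis unfolding V_def
        by (simp add: right_diff_distrib mult.assoc) (simp add: w_def power_divide)
    qed
    ultimately show ?thesis by (simp add: sum_subtractf flip: sum_distrib_right)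
  qed
  moreover have "(\<Sum>r = 1..p. real ((p + q - r - 1) choose (q - 1)) * w ^ (p + q - r) * U r) - real ((p + q - 1) choose (q - 1)) * w ^ (p + q)
     = (\<Sum>k = 0..p div 2. real ((p + q - 2 * k - 1) choose (q - 1)) * (2 * b * Lerch b (2 * k) 1 / (2 * real n) ^ (2 * k)) / l ^ (p + q - 2 * k))"
  proof -
    let ?f = "\<lambda>r. real ((p + q - r - 1) choose (q - 1)) * w ^ (p + q - r) * U r"
    \<comment> \<open>The continued values make \<open>2 * b * Lerch b 0 1 = -1\<close> for both
      signs, so the collected omitted terms fit as the summand \<open>r = 0\<close>.\<close>
    have "U 0 = -1" using b by (auto simp: U_def Lerch_def)
    then have "(\<Sum>r = 1..p. ?f r) - real ((p + q - 1) choose (q - 1)) * w ^ (p + q) = (\<Sum>r = 0..p. ?f r)"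
      by (simp add: sum.atLeast_Suc_atMost)
    also have "\<dots> = (\<Sum>r \<in> (\<lambda>k. 2 * k) ` {0..p div 2}. ?f r)"
    proof (rule sum.mono_neutral_right)
      show "\<forall>r\<in>{0..p} - (*) 2 ` {0..p div 2}. ?f r = 0"
      proof
        fix r assume r: "r \<in> {0..p} - (*) 2 ` {0..p div 2}"
        have "odd r"
        proof
          assume "even r"
          then have "r = 2 * (r div 2)" "r div 2 \<in> {0..p div 2}" using r by (auto intro: div_le_mono)
          then show False using r by blast
        qed
        then show "?f r = 0" by (simp add: U_def)
      qed
    qed auto
    also have "\<dots> = (\<Sum>k = 0..p div 2. ?f (2 * k))" by (subst sum.reindex) (auto simp: inj_on_def)
    also have "\<dots> = (\<Sum>k = 0..p div 2. real ((p + q - 2 * k - 1) choose (q - 1)) * (2 * b * Lerch b (2 * k) 1 / (2 * real n) ^ (2 * k)) / l ^ (p + q - 2 * k))"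
      by (intro sum.cong refl) (simp add: U_def w_def power_divide)
    finally show ?thesis .
  qed
  ultimately show ?thesis by (simp only: add_diff_eq diff_add_eq[symmetric])
qed

lemma sum_blocks:
  fixes f :: "nat \<Rightarrow> real"
  shows "(\<Sum>e<n * N. f e) = (\<Sum>j<n. \<Sum>i<N. f (n * i + j))"
proof (induction N)
  case (Suc N)
  have "(\<Sum>e<n * Suc N. f e) = (\<Sum>e<n * N + n. f e)" by (simp add: add.commute)
  then show ?case unfolding sum_split_add by (simp add: Suc sum.distrib)
qed simp

text \<open>Along \<open>e < n * N\<close> each residue class modulo \<open>n\<close> occurs exactly
  \<open>N\<close> times. For \<open>e = n * i + j\<close> one has
  \<open>a ^ e * b ^ i = a ^ j * c ^ i\<close>, which is the origin of the parameter
  \<open>c = a ^ n * b\<close>. The limit of the truncated sums is thus known in two ways, and its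
  uniqueness is solved for the series.\<close>

lemma double_series_value:
  fixes p q n :: nat and a b :: real
  assumes pqn: "p > 0" "q > 0" "n > 0"
    and b: "b \<in> {1, -1}"
    and a: "a = (-1) ^ (p + q - 1)"
    and cp: "a ^ n * b = 1 \<longrightarrow> p \<noteq> 1"
    and aq: "a = 1 \<longrightarrow> q \<noteq> 1"
  defines "G \<equiv> \<lambda>m. \<Sum>i<n * m. a ^ i / (2 * real i + 1) ^ q"
  defines "\<Gamma> \<equiv> Lerch a q (1/2) / 2 ^ q"
  defines "c \<equiv> a ^ n * b"
  shows "(\<lambda>m. c ^ Suc m / real (Suc m) ^ p * (\<Gamma> - G (Suc m))) sums
    (1 / 2 * ((1 - (-1) ^ p) * \<Gamma> * (c * Lerch c p 1)
     + (- 2 * real n) ^ p *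
      ((\<Sum>k = 0..p div 2. real ((p + q - 2 * k - 1) choose (q - 1)) * (2 * b * Lerch b (2 * k) 1 / (2 * real n) ^ (2 * k))
          * (Lerch a (p + q - 2 * k) (1/2) / 2 ^ (p + q - 2 * k)))
      + (\<Sum>j<n. \<Sum>k = 1..q. real ((p + q - k - 1) choose (p - 1)) * (Theta b k (2 * real j + 1) (2 * real n) / (2 * real n) ^ k)
          * (a ^ j * (Lerch c (p + q - k) ((2 * real j + 1) / (2 * real n)) / (2 * real n) ^ (p + q - k)))))))"
proof -
  have a1: "a \<in> {1, -1}" using a by (auto simp: minus_one_power_iff)
  have c1: "c \<in> {1, -1}" using a1 b by (cases "even n") (auto simp: c_def)
  define A where "A = (\<lambda>k. real ((p + q - 2 * k - 1) choose (q - 1)) * (2 * b * Lerch b (2 * k) 1 / (2 * real n) ^ (2 * k)))"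
  define B where "B = (\<lambda>j k. real ((p + q - k - 1) choose (p - 1)) * (Theta b k (2 * real j + 1) (2 * real n) / (2 * real n) ^ k))"
  define R where "R = (\<lambda>e. (- 2 * real n) ^ p *
      ((\<Sum>k = 0..p div 2. A k / (2 * real e + 1) ^ (p + q - 2 * k))
      + (\<Sum>k = 1..q. b ^ (e div n) * B (e mod n) k / (2 * real e + 1) ^ (p + q - k))))"
  have R: "(\<lambda>m. b ^ Suc m / real (Suc m) ^ p *
        (1 / (2 * real n * real (Suc m) + (2 * real e + 1)) ^ q
         + (-1) ^ p / (2 * real e + 1 - 2 * real n * real (Suc m)) ^ q)) sums R e" for e
  proof -
    have "n * (e div n) + e mod n = e" by simp
    then show ?thesis
      using bilateral_inner_sums[of p q "e mod n" n b "e div n"] pqn b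
      unfolding R_def A_def B_def by (simp add: mult_ac del: power_Suc of_nat_Suc)
  qed
  let ?L = "(- 2 * real n) ^ p *
      ((\<Sum>k = 0..p div 2. A k * (Lerch a (p + q - 2 * k) (1/2) / 2 ^ (p + q - 2 * k)))
      + (\<Sum>j<n. \<Sum>k = 1..q. B j k * (a ^ j * (Lerch c (p + q - k) ((2 * real j + 1) / (2 * real n)) / (2 * real n) ^ (p + q - k)))))"
  have "(\<lambda>N. (- 2 * real n) ^ p *
      ((\<Sum>k = 0..p div 2. A k * (\<Sum>e<n * N. a ^ e / (2 * real e + 1) ^ (p + q - 2 * k)))
      + (\<Sum>j<n. \<Sum>k = 1..q. B j k * (a ^ j * (\<Sum>i<N. c ^ i / (2 * real (n * i + j) + 1) ^ (p + q - k)))))) \<longlonglongrightarrow> ?L"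
  proof (intro tendsto_mult tendsto_const tendsto_add tendsto_sum)
    fix k assume k: "k \<in> {0..p div 2}"
    then have k2: "2 * k \<le> p" by auto
    \<comment> \<open>The exponent is at least \<open>q\<close> here and at least \<open>p\<close>
      in the Theta part. It can be 1 only for \<open>q = 1\<close> or \<open>p = 1\<close>, where
      \<open>aq\<close> or \<open>cp\<close> rules out the harmonic series.\<close>
    have "(\<lambda>e. a ^ e / (2 * real e + 1) ^ (p + q - 2 * k)) sums (Lerch a (p + q - 2 * k) (1/2) / 2 ^ (p + q - 2 * k))"
      by (rule odd_series_tail(1)) (use a1 aq pqn k2 in auto)
    then have "((\<lambda>M. \<Sum>e<M. a ^ e / (2 * real e + 1) ^ (p + q - 2 * k)) \<circ> (\<lambda>N. n * N))
        \<longlonglongrightarrow> Lerch a (p + q - 2 * k) (1/2) / 2 ^ (p + q - 2 * k)"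
      unfolding sums_def by (rule LIMSEQ_subseq_LIMSEQ) (use pqn in \<open>auto simp: strict_mono_def\<close>)
    then show "(\<lambda>N. \<Sum>e<n * N. a ^ e / (2 * real e + 1) ^ (p + q - 2 * k))
        \<longlonglongrightarrow> Lerch a (p + q - 2 * k) (1/2) / 2 ^ (p + q - 2 * k)" by (simp add: o_def)
  next
    fix j k assume jk: "j \<in> {..<n}" "k \<in> {1..q}"
    have "(\<lambda>i. c ^ i / (real i + (2 * real j + 1) / (2 * real n)) ^ (p + q - k) / (2 * real n) ^ (p + q - k))
        sums (Lerch c (p + q - k) ((2 * real j + 1) / (2 * real n)) / (2 * real n) ^ (p + q - k))"
      by (intro sums_divide Lerch_sums) (use c1 cp jk pqn in \<open>auto simp: c_def\<close>)
    moreover have "c ^ i / (real i + (2 * real j + 1) / (2 * real n)) ^ (p + q - k) / (2 * real n) ^ (p + q - k)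
        = c ^ i / (2 * real (n * i + j) + 1) ^ (p + q - k)" for i
    proof -
      have "(real i + (2 * real j + 1) / (2 * real n)) * (2 * real n) = 2 * real (n * i + j) + 1"
        using pqn by (simp add: field_simps)
      moreover have "c ^ i / x ^ r / y ^ r = c ^ i / (x * y) ^ r" for x y :: real and r
        by (simp add: power_mult_distrib)
      ultimately show ?thesis by (simp only:)
    qed
    ultimately show "(\<lambda>N. \<Sum>i<N. c ^ i / (2 * real (n * i + j) + 1) ^ (p + q - k))
        \<longlonglongrightarrow> Lerch c (p + q - k) ((2 * real j + 1) / (2 * real n)) / (2 * real n) ^ (p + q - k)"
      by (simp only: sums_def)
  qed
  moreover have "(\<Sum>e<n * N. a ^ e * R e) = (- 2 * real n) ^ p *
      ((\<Sum>k = 0..p div 2. A k * (\<Sum>e<n * N. a ^ e / (2 * real e + 1) ^ (p + q - 2 * k)))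
      + (\<Sum>j<n. \<Sum>k = 1..q. B j k * (a ^ j * (\<Sum>i<N. c ^ i / (2 * real (n * i + j) + 1) ^ (p + q - k)))))" for N
  proof -
    have "(\<Sum>e<n * N. a ^ e * (\<Sum>k = 1..q. b ^ (e div n) * B (e mod n) k / (2 * real e + 1) ^ (p + q - k)))
        = (\<Sum>j<n. \<Sum>i<N. \<Sum>k = 1..q. B j k * (a ^ j * (c ^ i / (2 * real (n * i + j) + 1) ^ (p + q - k))))"
      unfolding sum_blocks
    proof (intro sum.cong refl)
      fix j i assume "j \<in> {..<n}"
      then have "(n * i + j) div n = i" "(n * i + j) mod n = j" by auto
      moreover have "a ^ (n * i + j) * b ^ i = a ^ j * c ^ i"
        by (simp add: c_def power_add power_mult power_mult_distrib)
      ultimately show "a ^ (n * i + j) * (\<Sum>k = 1..q. b ^ ((n * i + j) div n) * B ((n * i + j) mod n) k / (2 * real (n * i + j) + 1) ^ (p + q - k))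
        = (\<Sum>k = 1..q. B j k * (a ^ j * (c ^ i / (2 * real (n * i + j) + 1) ^ (p + q - k))))"
        unfolding sum_distrib_left
      proof (intro sum.cong refl, goal_cases)
        case (1 k)
        define d where "d = (2 * real (n * i + j) + 1) ^ (p + q - k)"
        have "a ^ (n * i + j) * (b ^ i * B j k / d) = B j k * ((a ^ (n * i + j) * b ^ i) / d)" by (simp add: mult_ac)
        then show ?case using 1 by (simp add: d_def)
      qed
    qed
    also have "\<dots> = (\<Sum>j<n. \<Sum>k = 1..q. B j k * (a ^ j * (\<Sum>i<N. c ^ i / (2 * real (n * i + j) + 1) ^ (p + q - k))))"
      by (subst sum.swap) (simp add: sum_distrib_left)
    finally have 2: "(\<Sum>e<n * N. a ^ e * (\<Sum>k = 1..q. b ^ (e div n) * B (e mod n) k / (2 * real e + 1) ^ (p + q - k))) = \<dots>" .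
    have 1: "(\<Sum>e<n * N. a ^ e * (\<Sum>k = 0..p div 2. A k / (2 * real e + 1) ^ (p + q - 2 * k)))
        = (\<Sum>k = 0..p div 2. A k * (\<Sum>e<n * N. a ^ e / (2 * real e + 1) ^ (p + q - 2 * k)))"
      unfolding sum_distrib_left by (subst sum.swap) (simp add: mult_ac)
    have "(\<Sum>e<n * N. a ^ e * R e) = (- 2 * real n) ^ p *
      ((\<Sum>e<n * N. a ^ e * (\<Sum>k = 0..p div 2. A k / (2 * real e + 1) ^ (p + q - 2 * k)))
       + (\<Sum>e<n * N. a ^ e * (\<Sum>k = 1..q. b ^ (e div n) * B (e mod n) k / (2 * real e + 1) ^ (p + q - k))))"
      unfolding R_def sum.distrib[symmetric] sum_distrib_left[of "(- 2 * real n) ^ p"]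
      by (intro sum.cong refl) (simp only: distrib_left mult_ac)
    then show ?thesis unfolding 1 2 .
  qed
  ultimately have "(\<lambda>N. \<Sum>e<n * N. a ^ e * R e) \<longlonglongrightarrow> ?L" by simp
  from LIMSEQ_unique[OF bilateral_sum_limit(2)[OF pqn b a cp aq R] this]
  have eq: "(\<Sum>m. c ^ Suc m / real (Suc m) ^ p * (\<Gamma> - G (Suc m))) = 1 / 2 * ((1 - (-1) ^ p) * \<Gamma> * (c * Lerch c p 1) + ?L)"
    by (simp add: c_def G_def \<Gamma>_def)
  have "summable (\<lambda>m. c ^ Suc m / real (Suc m) ^ p * (\<Gamma> - G (Suc m)))"
    unfolding c_def G_def \<Gamma>_def by (rule bilateral_sum_limit(1)[OF pqn b a cp aq R])
  from summable_sums[OF this, unfolded eq] show ?thesis unfolding A_def B_def .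
qed

section \<open>Logarithmic integrals\<close>

lemma powr_times_ln_power_tendsto_0:
  fixes t :: real
  assumes "t > 0"
  shows "((\<lambda>x. x powr t * ln x ^ r) \<longlongrightarrow> 0) (at_right 0)"
  using assms
proof (induction r arbitrary: t)
  case 0
  then show ?case by simp real_asymp
next
  case (Suc r)
  have "((\<lambda>x. x powr (t/2) * ln x ^ r) \<longlongrightarrow> 0) (at_right 0)" using Suc by simp
  moreover have "((\<lambda>x. x powr (t/2) * ln x) \<longlongrightarrow> 0) (at_right 0)" using Suc.prems by real_asymp
  ultimately have "((\<lambda>x. (x powr (t/2) * ln x ^ r) * (x powr (t/2) * ln x)) \<longlongrightarrow> 0 * 0) (at_right 0)"
    by (rule tendsto_mult)
  moreover have "(x powr (t/2) * ln x ^ r) * (x powr (t/2) * ln x) = x powr t * ln x ^ Suc r" for x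
  proof -
    have "x powr t = x powr (t/2) * x powr (t/2)" by (simp flip: powr_add)
    then show ?thesis by (simp add: mult_ac)
  qed
  ultimately show ?case by simp
qed

lemma has_integral_powr_ln_power:
  fixes s :: real
  assumes "s > -1"
  shows "((\<lambda>x. x powr s * ln x ^ r) has_integral (-1) ^ r * fact r / (s + 1) ^ Suc r) {0<..<1}"
proof (induction r)
  case 0
  have "((\<lambda>x. x powr s) has_integral 1 powr (s + 1) / (s + 1)) {0..1}"
    by (rule has_integral_powr_from_0) (use assms in auto)
  then show ?case by (simp add: has_integral_Icc_iff_Ioo)
next
  case (Suc r)
  \<comment> \<open>Integration by parts in disguise: \<open>?F\<close> is 0 at both endpoints, at 1
    through the logarithm and at 0 because \<open>0 powr (s + 1) = 0\<close>, which is also its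
    limit there. So the two parts of its derivative have opposite integrals.\<close>
  let ?F = "\<lambda>x. x powr (s + 1) * ln x ^ Suc r / (s + 1)"
  let ?f = "\<lambda>x. x powr s * ln x ^ Suc r + real (Suc r) / (s + 1) * (x powr s * ln x ^ r)"
  have s: "s + 1 > 0" using assms by simp
  have "(?f has_integral (?F 1 - ?F 0)) {0..1}"
  proof (rule fundamental_theorem_of_calculus_interior)
    show "continuous_on {0..1} ?F"
      unfolding continuous_on_eq_continuous_within
    proof
      fix x :: real assume x: "x \<in> {0..1}"
      show "continuous (at x within {0..1}) ?F"
      proof (cases "x = 0")
        case True
        have "((\<lambda>x. x powr (s + 1) * ln x ^ Suc r / (s + 1)) \<longlongrightarrow> 0 / (s + 1)) (at_right 0)"
          by (intro tendsto_divide powr_times_ln_power_tendsto_0 tendsto_const) (use s in auto)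
        moreover have "at 0 within {0..1} = at_right (0::real)" by (simp add: at_within_Icc_at_right)
        ultimately show ?thesis using True by (simp add: continuous_within)
      next
        case False
        then show ?thesis using x s by (intro continuous_intros) auto
      qed
    qed
    show "(?F has_vector_derivative ?f x) (at x)" if "x \<in> {0<..<1}" for x
    proof -
      have "x powr (s + 1) = x powr s * x" using that by (simp add: powr_add)
      moreover have "x powr (s + 1 - 1) = x powr s" by simp
      ultimately show ?thesis
        using that s unfolding has_real_derivative_iff_has_vector_derivative[symmetric]
        by (auto intro!: derivative_eq_intros simp del: power_Suc) (simp add: field_simps)
    qed
  qed auto
  then have "(?f has_integral 0) {0<..<1}" by (simp add: has_integral_Icc_iff_Ioo)
  from has_integral_diff[OF this has_integral_mult_right[OF Suc, of "real (Suc r) / (s + 1)"]]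
  have "((\<lambda>x. x powr s * ln x ^ Suc r) has_integral 0 - real (Suc r) / (s + 1) * ((-1) ^ r * fact r / (s + 1) ^ Suc r)) {0<..<1}"
    by (simp only: add_diff_cancel_right')
  moreover have "0 - real (Suc r) / (s + 1) * ((-1) ^ r * fact r / (s + 1) ^ Suc r) = (-1) ^ Suc r * fact (Suc r) / (s + 1) ^ Suc (Suc r)"
    by simp
  ultimately show ?case by (simp only:)
qed

lemma has_integral_powr_abs_ln_power:
  fixes s :: real
  assumes "s > -1"
  shows "((\<lambda>x. x powr s * \<bar>ln x\<bar> ^ r) has_integral fact r / (s + 1) ^ Suc r) {0<..<1}"
proof -
  have "((\<lambda>x. (-1) ^ r * (x powr s * ln x ^ r)) has_integral (-1) ^ r * ((-1) ^ r * fact r / (s + 1) ^ Suc r)) {0<..<1}"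
    by (intro has_integral_mult_right has_integral_powr_ln_power assms)
  moreover have eq: "(-1) ^ r * (x powr s * ln x ^ r) = x powr s * \<bar>ln x\<bar> ^ r" if "x \<in> {0<..<1}" for x
  proof -
    have "\<bar>ln x\<bar> = (-1) * ln x" using that by simp
    then show ?thesis by (simp only: power_mult_distrib) simp
  qed
  ultimately have "((\<lambda>x. x powr s * \<bar>ln x\<bar> ^ r) has_integral (-1) ^ r * ((-1) ^ r * fact r / (s + 1) ^ Suc r)) {0<..<1}"
    by (rule has_integral_eq[rotated])
  then show ?thesis by simp
qed

text \<open>This is \<open>ln t \<le> t - 1\<close> at \<open>t = 1 / sqrt x\<close>. The factor
  \<open>1 - x\<close> will cancel a simple pole at 1, and passing to the square root keeps the
  price at 0 down to the integrable \<open>x powr (-1/2)\<close>.\<close>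

lemma abs_ln_le:
  fixes x :: real
  assumes "0 < x" "x < 1"
  shows "\<bar>ln x\<bar> \<le> 2 * (1 - x) * x powr (-1/2)"
proof -
  define y where "y = sqrt x"
  have y: "0 < y" "y < 1" "x = y\<^sup>2" using assms by (auto simp: y_def real_sqrt_lt_1_iff)
  have "ln (1 / y) \<le> 1 / y - 1" by (rule ln_le_minus_one) (use y in auto)
  then have "\<bar>ln x\<bar> \<le> 2 * (1 - y) / y" using y by (simp add: ln_div ln_realpow field_simps)
  also have "\<dots> \<le> 2 * ((1 - y) * (1 + y)) / y"
    using y by (intro divide_right_mono mult_left_mono) (auto simp: algebra_simps)
  also have "(1 - y) * (1 + y) = 1 - x" using y by (simp add: algebra_simps power2_eq_square)
  also have "2 * (1 - x) / y = 2 * (1 - x) * (1 / y)" by simp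
  also have "1 / y = x powr (-1/2)" using assms by (simp add: y_def powr_half_sqrt powr_minus divide_simps)
  finally show ?thesis .
qed

text \<open>Near \<open>x = 1\<close> a pole of \<open>1 / (1 - z x\<^sup>d)\<close> is compensated by one factor \<open>ln x\<close>.\<close>

lemma log_geometric_majorant:
  fixes z :: real
  assumes z: "\<bar>z\<bar> \<le> 1" "z = 1 \<longrightarrow> r > 0" and d: "d > 0"
  obtains D where "D integrable_on {0<..<1}"
    and "\<And>x. x \<in> {0<..<1} \<Longrightarrow> \<bar>x ^ M * ln x ^ r / (1 - z * x ^ d)\<bar> \<le> D x"
    and "z \<in> {1, -1} \<Longrightarrow> M > 0 \<Longrightarrow> integral {0<..<1} D \<le> 2 * fact r / real M"
proof -
  have xd: "x ^ d \<le> x" "0 < x ^ d" if "x \<in> {0<..<1}" for x :: real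
    using that d power_decreasing[of 1 d x] by auto
  \<comment> \<open>For \<open>z \<le> 0\<close> the denominator is at least 1; for
    \<open>z > 0\<close> a logarithm compensates it; without a logarithm \<open>z < 1\<close> keeps
    it away from 0. In the last case the claim about \<open>z \<in> {1, -1}\<close> is
    vacuous.\<close>
  consider "z \<le> 0" | "0 < z" "r > 0" | "0 < z" "z < 1" "r = 0" using z by force
  then show thesis
  proof cases
    case 1
    let ?D = "\<lambda>x. x powr real M * \<bar>ln x\<bar> ^ r"
    have D: "(?D has_integral fact r / (real M + 1) ^ Suc r) {0<..<1}"
      by (rule has_integral_powr_abs_ln_power) auto
    show thesis
    proof (rule that[of ?D])
      show "?D integrable_on {0<..<1}" using D by blast
      fix x :: real assume x: "x \<in> {0<..<1}"
      have "1 \<le> 1 - z * x ^ d" using 1 xd[OF x] by (simp add: mult_nonpos_nonneg)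
      then have "\<bar>x ^ M * ln x ^ r\<bar> / \<bar>1 - z * x ^ d\<bar> \<le> \<bar>x ^ M * ln x ^ r\<bar> / 1"
        by (intro divide_left_mono) auto
      then show "\<bar>x ^ M * ln x ^ r / (1 - z * x ^ d)\<bar> \<le> ?D x"
        using x by (simp add: abs_mult power_abs powr_realpow)
    next
      assume M: "M > 0"
      have "(real M + 1) ^ 1 \<le> (real M + 1) ^ Suc r" by (intro power_increasing) auto
      then have "real M \<le> (real M + 1) ^ Suc r" by (simp only: power_one_right)
      then have "fact r / (real M + 1) ^ Suc r \<le> fact r / real M"
        using M by (intro divide_left_mono) auto
      also have "\<dots> \<le> 2 * fact r / real M" using M by (simp add: divide_simps)
      finally show "integral {0<..<1} ?D \<le> 2 * fact r / real M" using integral_unique[OF D] by simp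
    qed
  next
    case 2
    then obtain r' where r': "r = Suc r'" by (cases r) auto
    \<comment> \<open>\<open>abs_ln_le\<close> spends one logarithm and half a power of
      \<open>x\<close>; the exponent \<open>M - 1/2\<close> still exceeds -1 at
      \<open>M = 0\<close>.\<close>
    let ?D = "\<lambda>x. 2 * (x powr (real M - 1/2) * \<bar>ln x\<bar> ^ r')"
    have D: "(?D has_integral 2 * (fact r' / (real M - 1/2 + 1) ^ Suc r')) {0<..<1}"
      by (intro has_integral_mult_right has_integral_powr_abs_ln_power) auto
    show thesis
    proof (rule that[of ?D])
      show "?D integrable_on {0<..<1}" using D by blast
      fix x :: real assume x: "x \<in> {0<..<1}"
      have "z * x ^ d \<le> 1 * x" using z xd[OF x] 2 by (intro mult_mono) auto
      then have den: "1 - x \<le> 1 - z * x ^ d" "0 < 1 - x" using x by auto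
      have "\<bar>x ^ M * ln x ^ r / (1 - z * x ^ d)\<bar> = x ^ M * \<bar>ln x\<bar> ^ r' * (\<bar>ln x\<bar> / (1 - z * x ^ d))"
        using x den by (simp add: abs_mult power_abs r')
      also have "\<bar>ln x\<bar> / (1 - z * x ^ d) \<le> \<bar>ln x\<bar> / (1 - x)"
        using den by (intro divide_left_mono) auto
      also have "\<dots> \<le> 2 * x powr (-1/2)"
      proof -
        have "\<bar>ln x\<bar> \<le> (2 * x powr (-1/2)) * (1 - x)" using abs_ln_le[of x] x by (simp add: algebra_simps)
        then show ?thesis by (simp only: pos_divide_le_eq[OF den(2)])
      qed
      finally have "\<bar>x ^ M * ln x ^ r / (1 - z * x ^ d)\<bar> \<le> x ^ M * \<bar>ln x\<bar> ^ r' * (2 * x powr (-1/2))"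
        using x by (simp add: mult_left_mono)
      also have "\<dots> = ?D x"
      proof -
        have "x powr (real M - 1/2) = x powr real M * x powr (-1/2)" by (simp flip: powr_add)
        then show ?thesis using x by (simp add: powr_realpow)
      qed
      finally show "\<bar>x ^ M * ln x ^ r / (1 - z * x ^ d)\<bar> \<le> ?D x" .
    next
      assume M: "M > 0"
      have "(real M + 1/2) ^ 1 \<le> (real M + 1/2) ^ Suc r'" using M by (intro power_increasing) auto
      then have "2 * (fact r' / (real M + 1/2) ^ Suc r') \<le> 2 * (fact r / real M)"
        using M by (intro mult_left_mono frac_le fact_mono) (auto simp: r' simp del: power_Suc)
      moreover have "real M - 1/2 + 1 = real M + 1/2" by simp
      ultimately show "integral {0<..<1} ?D \<le> 2 * fact r / real M"
        unfolding integral_unique[OF D] by (simp only:)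
    qed
  next
    case 3
    let ?D = "\<lambda>x::real. 1 / (1 - z)"
    show thesis
    proof (rule that[of ?D])
      show "?D integrable_on {0<..<1}" by (simp only: integrable_on_Icc_iff_Ioo[symmetric] integrable_const_ivl)
      fix x :: real assume x: "x \<in> {0<..<1}"
      have "z * x ^ d \<le> z * 1" using 3 xd[OF x] x by (intro mult_left_mono) auto
      then have "1 - z \<le> \<bar>1 - z * x ^ d\<bar>" by linarith
      then show "\<bar>x ^ M * ln x ^ r / (1 - z * x ^ d)\<bar> \<le> ?D x"
        using 3 x by (auto simp: abs_mult intro!: frac_le power_le_one)
    qed (use 3 in auto)
  qed
qed

lemma log_geometric_absolutely_integrable:
  fixes z :: real
  assumes z: "\<bar>z\<bar> \<le> 1" "z = 1 \<longrightarrow> r > 0" and d: "d > 0"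
  shows "(\<lambda>x. x ^ M * ln x ^ r / (1 - z * x ^ d)) absolutely_integrable_on {0<..<1}"
proof -
  obtain D where D: "D integrable_on {0<..<1}"
    and le: "\<And>x. x \<in> {0<..<1} \<Longrightarrow> \<bar>x ^ M * ln x ^ r / (1 - z * x ^ d)\<bar> \<le> D x"
    using log_geometric_majorant[OF assms] by metis
  show ?thesis
  proof (rule measurable_bounded_by_integrable_imp_absolutely_integrable[OF _ _ D])
    have "1 - z * x ^ d \<noteq> 0" if "x \<in> {0<..<1}" for x
    proof -
      have "\<bar>z * x ^ d\<bar> = \<bar>z\<bar> * x ^ d" using that by (simp add: abs_mult)
      also have "\<dots> \<le> 1 * x ^ d" using z that by (intro mult_right_mono) auto
      also have "\<dots> < 1" using that d by (simp add: power_less_one_iff)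
      finally show ?thesis by auto
    qed
    then have "continuous_on {0<..<1} (\<lambda>x. x ^ M * ln x ^ r / (1 - z * x ^ d))"
      by (intro continuous_intros) auto
    then show "(\<lambda>x. x ^ M * ln x ^ r / (1 - z * x ^ d)) \<in> borel_measurable (lebesgue_on {0<..<1})"
      by (rule continuous_imp_measurable_on_sets_lebesgue) auto
  qed (use le in auto)
qed

text \<open>For \<open>z = -1\<close> and \<open>r = 0\<close> the integrated series converges only
  conditionally, so domination term by term would fail. The partial sums equal
  \<open>1 - (z * x ^ d) ^ K\<close> times the limit function, hence are at most twice that function
  in absolute value.\<close>

lemma log_geometric_integral_sums:
  fixes z :: real
  assumes z: "\<bar>z\<bar> \<le> 1" "z = 1 \<longrightarrow> r > 0" and d: "d > 0"
  shows "(\<lambda>k. (-1) ^ r * fact r * z ^ k / real (M + d * k + 1) ^ Suc r) sums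
    integral {0<..<1} (\<lambda>x. x ^ M * ln x ^ r / (1 - z * x ^ d))"
proof -
  let ?g = "\<lambda>x. x ^ M * ln x ^ r / (1 - z * x ^ d)"
  let ?f = "\<lambda>K x. \<Sum>k<K. z ^ k * (x ^ (M + d * k) * ln x ^ r)"
  have zx: "\<bar>z * x ^ d\<bar> < 1" if "x \<in> {0<..<1}" for x
  proof -
    have "\<bar>z * x ^ d\<bar> = \<bar>z\<bar> * x ^ d" using that by (simp add: abs_mult)
    also have "\<dots> \<le> 1 * x ^ d" using z that by (intro mult_right_mono) auto
    also have "\<dots> < 1" using that d by (simp add: power_less_one_iff)
    finally show ?thesis .
  qed
  have monomial: "((\<lambda>x. x ^ (M + d * k) * ln x ^ r) has_integral (-1) ^ r * fact r / real (M + d * k + 1) ^ Suc r) {0<..<1}" for k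
  proof -
    have "((\<lambda>x. x powr real (M + d * k) * ln x ^ r) has_integral (-1) ^ r * fact r / (real (M + d * k) + 1) ^ Suc r) {0<..<1}"
      by (rule has_integral_powr_ln_power) (use of_nat_0_le_iff[of "M + d * k"] in linarith)
    moreover have "x powr real (M + d * k) * ln x ^ r = x ^ (M + d * k) * ln x ^ r" if "x \<in> {0<..<1}" for x
      using that by (subst powr_realpow) auto
    ultimately have "((\<lambda>x. x ^ (M + d * k) * ln x ^ r) has_integral (-1) ^ r * fact r / (real (M + d * k) + 1) ^ Suc r) {0<..<1}"
      by (rule has_integral_eq[rotated])
    then show ?thesis by (simp add: add_ac)
  qed
  have f_int: "(?f K has_integral (\<Sum>k<K. z ^ k * ((-1) ^ r * fact r / real (M + d * k + 1) ^ Suc r))) {0<..<1}" for K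
    by (intro has_integral_sum has_integral_mult_right monomial) auto
  have f_eq: "?f K x = (1 - (z * x ^ d) ^ K) * ?g x" if "x \<in> {0<..<1}" for K x
  proof -
    have "?f K x = x ^ M * ln x ^ r * (\<Sum>k<K. (z * x ^ d) ^ k)"
      unfolding sum_distrib_left by (intro sum.cong) (auto simp: power_add power_mult power_mult_distrib)
    also have "(\<Sum>k<K. (z * x ^ d) ^ k) = (1 - (z * x ^ d) ^ K) / (1 - z * x ^ d)"
      using zx[OF that] by (subst sum_gp_strict) auto
    finally show ?thesis by simp
  qed
  have "(\<lambda>K. integral {0<..<1} (?f K)) \<longlonglongrightarrow> integral {0<..<1} ?g"
  proof (rule dominated_convergence(2))
    show "?f K integrable_on {0<..<1}" for K using f_int by blast
    show "(\<lambda>x. 2 * \<bar>?g x\<bar>) integrable_on {0<..<1}"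
      using log_geometric_absolutely_integrable[OF assms, of M] unfolding absolutely_integrable_on_def
      by (intro integrable_on_mult_right) auto
    fix x :: real assume x: "x \<in> {0<..<1}"
    show "norm (?f K x) \<le> 2 * \<bar>?g x\<bar>" for K
    proof -
      have "\<bar>(z * x ^ d) ^ K\<bar> \<le> 1" using zx[OF x] by (simp add: power_abs power_le_one)
      then have "\<bar>1 - (z * x ^ d) ^ K\<bar> \<le> 2" by linarith
      then show ?thesis unfolding f_eq[OF x] real_norm_def abs_mult[of _ "?g x"] by (intro mult_right_mono) auto
    qed
    have "(\<lambda>K. (1 - (z * x ^ d) ^ K) * ?g x) \<longlonglongrightarrow> (1 - 0) * ?g x"
      by (intro tendsto_intros LIMSEQ_power_zero) (use zx[OF x] in auto)
    then show "(\<lambda>K. ?f K x) \<longlonglongrightarrow> ?g x" unfolding f_eq[OF x] by simp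
  qed
  then show ?thesis
    unfolding sums_def integral_unique[OF f_int] by (simp add: mult_ac)
qed

section \<open>Termwise integration of the polylogarithm series\<close>

lemma has_integral_sums:
  fixes f :: "nat \<Rightarrow> real \<Rightarrow> real"
  assumes f: "\<And>m. f m absolutely_integrable_on S"
    and S: "S \<in> sets lebesgue"
    and sums: "\<And>x. x \<in> S \<Longrightarrow> (\<lambda>m. f m x) sums g x"
    and abs: "\<And>x. x \<in> S \<Longrightarrow> summable (\<lambda>m. \<bar>f m x\<bar>)"
    and abs_int: "summable (\<lambda>m. integral S (\<lambda>x. \<bar>f m x\<bar>))"
    and I: "(\<lambda>m. integral S (f m)) sums I"
  shows "(g has_integral I) S"
proof -
  \<comment> \<open>Extension by zero turns the integrals over \<open>S\<close> into Lebesgue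
    integrals over the line, where summability of the integrated absolute values permits the
    exchange.\<close>
  let ?h = "\<lambda>m x. indicator S x *\<^sub>R f m x"
  have h: "integrable lebesgue (?h m)" for m using f[of m] by (simp add: set_integrable_def)
  have abs_eq: "(\<integral>x. norm (?h m x) \<partial>lebesgue) = integral S (\<lambda>x. \<bar>f m x\<bar>)" for m
  proof -
    have "(\<lambda>x. \<bar>f m x\<bar>) absolutely_integrable_on S" using absolutely_integrable_norm[OF f[of m]] by (simp add: o_def)
    from set_lebesgue_integral_eq_integral(2)[OF this] show ?thesis
      unfolding set_lebesgue_integral_def by (simp add: abs_mult)
  qed
  have int_eq: "integral\<^sup>L lebesgue (?h m) = integral S (f m)" for m
    using set_lebesgue_integral_eq_integral(2)[OF f[of m]] by (simp add: set_lebesgue_integral_def)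
  have ae: "AE x in lebesgue. summable (\<lambda>m. norm (?h m x))"
  proof (rule AE_I2)
    fix x show "summable (\<lambda>m. norm (?h m x))" using abs[of x] by (cases "x \<in> S") auto
  qed
  have sm: "summable (\<lambda>m. \<integral>x. norm (?h m x) \<partial>lebesgue)" unfolding abs_eq by (rule abs_int)
  have suminf: "(\<lambda>x. \<Sum>m. ?h m x) = (\<lambda>x. indicator S x *\<^sub>R g x)"
    using sums by (auto simp: fun_eq_iff sums_iff split: split_indicator)
  have "set_integrable lebesgue S g"
    using integrable_suminf[OF h ae sm] unfolding suminf set_integrable_def .
  moreover have "(\<lambda>m. integral S (f m)) sums (LINT x:S|lebesgue. g x)"
    using sums_integral[OF h ae sm] unfolding suminf int_eq set_lebesgue_integral_def .
  ultimately show ?thesis using sums_unique2[OF I] has_integral_set_lebesgue by fastforce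
qed

lemma Li_sums:
  assumes "p > 0" "\<bar>x\<bar> \<le> 1" "x = 1 \<longrightarrow> p \<noteq> 1"
  shows "(\<lambda>m. x ^ Suc m / real (Suc m) ^ p) sums Li p x"
proof -
  obtain r where r: "p = Suc r" using assms(1) by (cases p) auto
  have "(\<lambda>k. (-1) ^ r * fact r * x ^ k / real (0 + 1 * k + 1) ^ Suc r) sums
      integral {0<..<1} (\<lambda>y. y ^ 0 * ln y ^ r / (1 - x * y ^ 1))"
    by (rule log_geometric_integral_sums) (use assms r in auto)
  from sums_mult[OF this, of "(-1) ^ r / fact r * x"]
  have "(\<lambda>k. (-1) ^ r / fact r * x * ((-1) ^ r * fact r * x ^ k / real (Suc k) ^ p)) sums
      ((-1) ^ r / fact r * (x * integral {0<..<1} (\<lambda>y. ln y ^ r / (1 - x * y))))"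
    by (simp add: r mult.assoc del: power_Suc of_nat_Suc)
  moreover have "(-1) ^ r / fact r * x * ((-1) ^ r * fact r * x ^ k / real (Suc k) ^ p) = x ^ Suc k / real (Suc k) ^ p" for k
    by (simp del: of_nat_Suc)
  moreover have "Li p x = (-1) ^ r / fact r * (x * integral {0<..<1} (\<lambda>y. ln y ^ r / (1 - x * y)))"
  proof -
    have "integral {0..1} (\<lambda>y. x * ln y ^ r / (1 - x * y)) = x * integral {0<..<1} (\<lambda>y. ln y ^ r / (1 - x * y))"
      unfolding integral_open_interval_real
      using integral_mult_right[of "{0<..<1}" x "\<lambda>y. ln y ^ r / (1 - x * y)"] by simp
    then show ?thesis using assms by (simp add: Li_def r)
  qed
  ultimately show ?thesis by (simp only:)
qed

text \<open>Only \<open>Li\<close> is expanded while \<open>1 / (1 - a * x\<^sup>2)\<close> stays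
  intact. The integral of the term with power \<open>2 * n * m\<close> is then of order
  \<open>1 / m\<close>, and with the coefficient \<open>1 / m ^ p\<close> the sum converges
  absolutely even for \<open>p = q = 1\<close>, where the full double series need not.\<close>

lemma log_Li_integral:
  fixes p q n :: nat and a b :: real
  assumes pqn: "p > 0" "q > 0" "n > 0"
    and b: "b \<in> {1, -1}" and a: "a \<in> {1, -1}" and aq: "a = 1 \<longrightarrow> q \<noteq> 1"
    and S: "(\<lambda>m. (a ^ n * b) ^ Suc m / real (Suc m) ^ p *
      (Lerch a q (1/2) / 2 ^ q - (\<Sum>i<n * Suc m. a ^ i / (2 * real i + 1) ^ q))) sums S"
  shows "((\<lambda>x. ln x ^ (q - 1) * Li p (b * x ^ (2 * n)) / (1 - a * x\<^sup>2)) has_integral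
    (-1) ^ (q - 1) * fact (q - 1) * S) {0<..<1}"
proof -
  define r where "r = q - 1"
  have q: "q = Suc r" using pqn by (simp add: r_def)
  let ?h = "\<lambda>m x. x ^ (2 * n * Suc m) * ln x ^ r / (1 - a * x ^ 2)"
  let ?f = "\<lambda>m x. b ^ Suc m / real (Suc m) ^ p * ?h m x"
  have hyp: "\<bar>a\<bar> \<le> 1" "a = 1 \<longrightarrow> r > 0" "(2::nat) > 0" using a aq q by auto
  have h_abs: "?h m absolutely_integrable_on {0<..<1}" for m
    by (rule log_geometric_absolutely_integrable[OF hyp])
  have f_abs: "?f m absolutely_integrable_on {0<..<1}" for m
    using set_integrable_mult_right[OF h_abs[of m], of "b ^ Suc m / real (Suc m) ^ p"] by simp
  have x2n: "0 \<le> x ^ (2 * n)" "x ^ (2 * n) < 1" if "x \<in> {0<..<1}" for x :: real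
    using that pqn power_less_one_iff[of x "2 * n"] by auto
  have Li_series: "(\<lambda>m. (b * x ^ (2 * n)) ^ Suc m / real (Suc m) ^ p) sums Li p (b * x ^ (2 * n))"
    if "x \<in> {0<..<1}" for x
  proof -
    obtain y where y: "y = x ^ (2 * n)" by blast
    then have "0 \<le> y" "y < 1" using x2n[OF that] by simp_all
    then show ?thesis
      unfolding y[symmetric] by (intro Li_sums) (use b pqn in \<open>auto simp: abs_mult\<close>)
  qed
  have f_eq: "?f m x = ln x ^ r / (1 - a * x\<^sup>2) * ((b * x ^ (2 * n)) ^ Suc m / real (Suc m) ^ p)" for m x
  proof -
    have "x ^ (2 * n * Suc m) = (x ^ (2 * n)) ^ Suc m" by (rule power_mult)
    then show ?thesis
      by (simp only: power_mult_distrib times_divide_eq_right times_divide_eq_left divide_divide_eq_left mult_ac)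
  qed
  have "((\<lambda>x. ln x ^ r / (1 - a * x\<^sup>2) * Li p (b * x ^ (2 * n))) has_integral (-1) ^ r * fact r * S) {0<..<1}"
  proof (rule has_integral_sums[where f = ?f])
    show "(\<lambda>m. ?f m x) sums (ln x ^ r / (1 - a * x\<^sup>2) * Li p (b * x ^ (2 * n)))" if "x \<in> {0<..<1}" for x
      unfolding f_eq by (intro sums_mult Li_series that)
    show "summable (\<lambda>m. \<bar>?f m x\<bar>)" if "x \<in> {0<..<1}" for x
    proof (rule summable_comparison_test_ev)
      show "summable (\<lambda>m. \<bar>ln x ^ r / (1 - a * x\<^sup>2)\<bar> * (x ^ (2 * n)) ^ m)"
        by (intro summable_mult summable_geometric) (use x2n[OF that] in auto)
      have "norm \<bar>?f m x\<bar> \<le> \<bar>ln x ^ r / (1 - a * x\<^sup>2)\<bar> * (x ^ (2 * n)) ^ m" for m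
      proof -
        obtain y where y: "y = x ^ (2 * n)" by blast
        then have y01: "0 \<le> y" "y < 1" using x2n[OF that] by simp_all
        have "\<bar>b\<bar> = 1" using b by auto
        then have "\<bar>(b * y) ^ Suc m / real (Suc m) ^ p\<bar> = y ^ Suc m / real (Suc m) ^ p"
          using y01 by (simp add: abs_mult power_abs del: power_Suc)
        also have "\<dots> \<le> y ^ Suc m / 1"
          using y01 by (intro divide_left_mono zero_le_power one_le_power) auto
        also have "\<dots> \<le> y ^ m"
          using y01 power_decreasing[of m "Suc m" y] by simp
        finally have "\<bar>(b * x ^ (2 * n)) ^ Suc m / real (Suc m) ^ p\<bar> \<le> (x ^ (2 * n)) ^ m" unfolding y .
        moreover have "norm \<bar>?f m x\<bar> = \<bar>ln x ^ r / (1 - a * x\<^sup>2)\<bar> * \<bar>(b * x ^ (2 * n)) ^ Suc m / real (Suc m) ^ p\<bar>"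
          unfolding f_eq by (simp only: abs_mult real_norm_def abs_abs)
        ultimately show ?thesis by (simp only:) (intro mult_left_mono, auto)
      qed
      then show "\<forall>\<^sub>F m in sequentially. norm \<bar>?f m x\<bar> \<le> \<bar>ln x ^ r / (1 - a * x\<^sup>2)\<bar> * (x ^ (2 * n)) ^ m"
        by auto
    qed
    show "summable (\<lambda>m. integral {0<..<1} (\<lambda>x. \<bar>?f m x\<bar>))"
    proof (rule summable_comparison_test_ev)
      show "summable (\<lambda>m. 2 * fact r * (1 / (real m + 1) ^ 2))"
        by (intro summable_mult summable_inverse_shifted_power) auto
      have "norm (integral {0<..<1} (\<lambda>x. \<bar>?f m x\<bar>)) \<le> 2 * fact r * (1 / (real m + 1) ^ 2)" for m
      proof -
        have b1: "\<bar>b ^ Suc m\<bar> = 1" using b by (auto simp: power_abs)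
        have "0 < 2 * n * Suc m" using pqn by simp
        then obtain D where D: "D integrable_on {0<..<1}"
          and le: "\<And>x. x \<in> {0<..<1} \<Longrightarrow> \<bar>?h m x\<bar> \<le> D x"
          and D_int: "integral {0<..<1} D \<le> 2 * fact r / real (2 * n * Suc m)"
          using log_geometric_majorant[OF hyp, of "2 * n * Suc m"] a by metis
        have h_int: "(\<lambda>x. \<bar>?h m x\<bar>) integrable_on {0<..<1}"
          using h_abs[of m] by (simp add: absolutely_integrable_on_def)
        have "integral {0<..<1} (\<lambda>x. \<bar>?f m x\<bar>) = 1 / real (Suc m) ^ p * integral {0<..<1} (\<lambda>x. \<bar>?h m x\<bar>)"
          unfolding integral_mult_right[symmetric] abs_mult[of "b ^ Suc m / real (Suc m) ^ p"] abs_divide[of "b ^ Suc m"] b1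
          by simp
        also have "\<dots> \<le> 1 / real (Suc m) * (2 * fact r / real (Suc m))"
        proof (rule mult_mono)
          show "1 / real (Suc m) ^ p \<le> 1 / real (Suc m)"
            using pqn self_le_power[of "real (Suc m)" p] by (intro divide_left_mono) auto
          have "integral {0<..<1} (\<lambda>x. \<bar>?h m x\<bar>) \<le> integral {0<..<1} D"
            by (rule integral_le[OF h_int D le])
          also note D_int
          also have "2 * fact r / real (2 * n * Suc m) \<le> 2 * fact r / real (Suc m)"
          proof (rule frac_le)
            show "real (Suc m) \<le> real (2 * n * Suc m)"
              unfolding of_nat_le_iff using pqn by (cases n) auto
          qed auto
          finally show "integral {0<..<1} (\<lambda>x. \<bar>?h m x\<bar>) \<le> 2 * fact r / real (Suc m)" .
          show "0 \<le> integral {0<..<1} (\<lambda>x. \<bar>?h m x\<bar>)" by (rule integral_nonneg[OF h_int]) simp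
        qed simp
        also have "\<dots> = 2 * fact r * (1 / (real m + 1) ^ 2)" by (simp add: power2_eq_square add.commute)
        finally have "integral {0<..<1} (\<lambda>x. \<bar>?f m x\<bar>) \<le> 2 * fact r * (1 / (real m + 1) ^ 2)" .
        moreover have "0 \<le> integral {0<..<1} (\<lambda>x. \<bar>?f m x\<bar>)"
          using f_abs[of m] by (intro integral_nonneg) (auto simp: absolutely_integrable_on_def)
        ultimately show ?thesis by (simp only: real_norm_def abs_of_nonneg)
      qed
      then show "\<forall>\<^sub>F m in sequentially. norm (integral {0<..<1} (\<lambda>x. \<bar>?f m x\<bar>)) \<le> 2 * fact r * (1 / (real m + 1) ^ 2)"
        by auto
    qed
    show "(\<lambda>m. integral {0<..<1} (?f m)) sums ((-1) ^ r * fact r * S)"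
    proof -
      have "integral {0<..<1} (?f m) = (-1) ^ r * fact r * ((a ^ n * b) ^ Suc m / real (Suc m) ^ p *
        (Lerch a q (1/2) / 2 ^ q - (\<Sum>i<n * Suc m. a ^ i / (2 * real i + 1) ^ q)))" for m
      proof -
        let ?M = "n * Suc m"
        \<comment> \<open>Multiplying by \<open>a ^ ?M\<close> undoes the index shift, so the
          integral of \<open>?h m\<close> is \<open>(-1) ^ r * fact r * a ^ ?M\<close> times the
          part of the odd series after its first \<open>?M\<close> terms.\<close>
        have aa: "a ^ ?M * a ^ ?M = 1" using a by (auto simp flip: power_mult_distrib)
        have "(\<lambda>k. a ^ (k + ?M) / (2 * real (k + ?M) + 1) ^ q) sums (Lerch a q (1/2) / 2 ^ q - (\<Sum>i<?M. a ^ i / (2 * real i + 1) ^ q))"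
          by (intro sums_split_initial_segment odd_series_tail(1)) (use a aq pqn in auto)
        from sums_mult[OF this, of "(-1) ^ r * fact r * a ^ ?M"]
        have "(\<lambda>k. (-1) ^ r * fact r * a ^ ?M * (a ^ (k + ?M) / (2 * real (k + ?M) + 1) ^ q)) sums
          ((-1) ^ r * fact r * a ^ ?M * (Lerch a q (1/2) / 2 ^ q - (\<Sum>i<?M. a ^ i / (2 * real i + 1) ^ q)))" .
        moreover have "(-1) ^ r * fact r * a ^ ?M * (a ^ (k + ?M) / (2 * real (k + ?M) + 1) ^ q)
          = (-1) ^ r * fact r * a ^ k / real (2 * n * Suc m + 2 * k + 1) ^ Suc r" for k
        proof -
          have "a ^ ?M * a ^ (k + ?M) = a ^ k" using aa by (simp only: power_add mult.left_commute mult_1_right)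
          moreover have "2 * real (k + ?M) + 1 = real (2 * n * Suc m + 2 * k + 1)"
            by (simp only: of_nat_add of_nat_mult of_nat_1 of_nat_numeral) (simp add: algebra_simps)
          ultimately show ?thesis by (simp only: q mult.assoc times_divide_eq_right)
        qed
        moreover note log_geometric_integral_sums[OF hyp, of "2 * n * Suc m"]
        ultimately have "integral {0<..<1} (?h m) = (-1) ^ r * fact r * a ^ ?M * (Lerch a q (1/2) / 2 ^ q - (\<Sum>i<?M. a ^ i / (2 * real i + 1) ^ q))"
          by (simp only:) (rule sums_unique2)
        moreover have "(a ^ n * b) ^ Suc m = a ^ ?M * b ^ Suc m" by (simp only: power_mult_distrib power_mult)
        moreover have "integral {0<..<1} (?f m) = b ^ Suc m / real (Suc m) ^ p * integral {0<..<1} (?h m)"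
          by (rule integral_mult_right)
        ultimately show ?thesis
          by (simp only: times_divide_eq_left times_divide_eq_right mult_ac)
      qed
      then show ?thesis using sums_mult[OF S, of "(-1) ^ r * fact r"] by (simp only:)
    qed
  qed (use f_abs in auto)
  then show ?thesis by (simp add: r_def)
qed

section \<open>Inversion of the polylogarithm\<close>

lemma log_kernel_integrable:
  fixes b t :: real
  assumes b: "b \<in> {1, -1}" and t: "0 \<le> t" "t \<le> 1" "b = 1 \<longrightarrow> j > 0 \<or> t < 1"
  shows "(\<lambda>u. ln u ^ j / (1 - b * u)) integrable_on {0..t}"
proof (cases "b = 1 \<and> j = 0")
  case True
  then have "1 - b * u \<noteq> 0" if "u \<in> {0..t}" for u using t that by auto
  then have "continuous_on {0..t} (\<lambda>u. 1 / (1 - b * u))"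
    by (intro continuous_intros) auto
  then show ?thesis using True integrable_continuous_real by force
next
  case False
  have "(\<lambda>u. u ^ 0 * ln u ^ j / (1 - b * u ^ 1)) absolutely_integrable_on {0<..<1}"
    by (rule log_geometric_absolutely_integrable) (use b False in auto)
  then have "(\<lambda>u. ln u ^ j / (1 - b * u)) integrable_on {0..1}"
    by (simp add: absolutely_integrable_on_def integrable_on_Icc_iff_Ioo)
  then show ?thesis by (rule integrable_on_subinterval) (use t in auto)
qed

text \<open>With \<open>L = ln z\<close> the base \<open>s * ln u + L\<close> is
  \<open>ln (z * u)\<close> for \<open>s = 1\<close> and \<open>ln (z / u)\<close> for
  \<open>s = -1\<close>, the logarithms arising on the two sides of the pole.\<close>

lemma log_kernel_binomial:
  fixes b t L s :: real
  assumes b: "b \<in> {1, -1}" and t: "0 \<le> t" "t \<le> 1" "b = 1 \<longrightarrow> t < 1"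
  shows "((\<lambda>u. (s * ln u + L) ^ r / (1 - b * u)) has_integral
    (\<Sum>j\<le>r. real (r choose j) * L ^ (r - j) * s ^ j * integral {0..t} (\<lambda>u. ln u ^ j / (1 - b * u)))) {0..t}"
proof -
  have "((\<lambda>u. \<Sum>j\<le>r. real (r choose j) * L ^ (r - j) * s ^ j * (ln u ^ j / (1 - b * u))) has_integral
    (\<Sum>j\<le>r. real (r choose j) * L ^ (r - j) * s ^ j * integral {0..t} (\<lambda>u. ln u ^ j / (1 - b * u)))) {0..t}"
    by (intro has_integral_sum has_integral_mult_right integrable_integral log_kernel_integrable) (use assms in auto)
  moreover have "(\<Sum>j\<le>r. real (r choose j) * L ^ (r - j) * s ^ j * (ln u ^ j / (1 - b * u))) = (s * ln u + L) ^ r / (1 - b * u)" for u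
    unfolding binomial_ring sum_divide_distrib by (intro sum.cong refl) (simp add: power_mult_distrib)
  ultimately show ?thesis by simp
qed

text \<open>The substitution \<open>y = z u\<close> below the pole \<open>z\<close> and \<open>y = z / v\<close> above it turn the two pieces of the
  integral defining \<open>Li (b / z)\<close> into integrals with the same kernel \<open>1 / (1 - b u)\<close>.\<close>

lemma Li_inversion_truncated:
  fixes b z \<epsilon> :: real and r :: nat
  assumes b: "b \<in> {1, -1}" and z: "0 < z" "z < 1" and \<epsilon>: "0 \<le> \<epsilon>" "\<epsilon> < z" "\<epsilon> < 1 - z" "b = 1 \<longrightarrow> \<epsilon> > 0"
  defines "J \<equiv> \<lambda>j t. integral {0..t} (\<lambda>u. ln u ^ j / (1 - b * u))"
  defines "F \<equiv> \<lambda>y. b / z * ln y ^ r / (1 - b / z * y)"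
  shows "F integrable_on {0..z - \<epsilon>}" "F integrable_on {z + \<epsilon>..1}"
    and "integral {0..z - \<epsilon>} F + integral {z + \<epsilon>..1} F
      = b * (\<Sum>j\<le>r. real (r choose j) * ln z ^ (r - j) * (J j (1 - \<epsilon> / z) - (-1) ^ j * J j (z / (z + \<epsilon>))))
        + fact r * Li (Suc r) (b * z) + (ln z - ln (z / (z + \<epsilon>))) ^ Suc r / real (Suc r)"
proof -
  define L where "L = ln z"
  define \<alpha> where "\<alpha> = 1 - \<epsilon> / z"
  define \<beta> where "\<beta> = z / (z + \<epsilon>)"
  have bb: "b * b = 1" using b by auto
  have \<alpha>: "0 \<le> \<alpha>" "\<alpha> \<le> 1" "b = 1 \<longrightarrow> \<alpha> < 1" using z \<epsilon> by (auto simp: \<alpha>_def)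
  have \<beta>: "0 < \<beta>" "\<beta> \<le> 1" "b = 1 \<longrightarrow> \<beta> < 1" "z \<le> \<beta>"
    using z \<epsilon> by (auto simp: \<beta>_def divide_simps)
  define I where "I = (\<lambda>s t. \<Sum>j\<le>r. real (r choose j) * L ^ (r - j) * s ^ j * J j t)"
  have I: "((\<lambda>u. (s * ln u + L) ^ r / (1 - b * u)) has_integral I s t) {0..t}"
    if "0 \<le> t" "t \<le> 1" "b = 1 \<longrightarrow> t < 1" for s t
    unfolding I_def J_def by (rule log_kernel_binomial) (use b that in auto)
  have below: "(F has_integral b * I 1 \<alpha>) {0..z - \<epsilon>}"
  proof -
    have "((\<lambda>x. (1 * ln (1 / z * x) + L) ^ r / (1 - b * (1 / z * x))) has_integral (1 / \<bar>1 / z\<bar>) *\<^sub>R I 1 \<alpha>)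
        ((\<lambda>x. x / (1 / z)) ` {0..\<alpha>})"
      by (rule has_integral_stretch_real[OF I]) (use \<alpha> z in auto)
    moreover have "(\<lambda>x. x / (1 / z)) ` {0..\<alpha>} = {0..z - \<epsilon>}"
    proof -
      have "(\<lambda>x. x / (1 / z)) = (*) z" by (auto simp: mult.commute)
      moreover have "z * \<alpha> = z - \<epsilon>" using z by (simp add: \<alpha>_def algebra_simps)
      ultimately show ?thesis using image_mult_atLeastAtMost[of z 0 \<alpha>] z by (simp only: mult_zero_right)
    qed
    ultimately have "((\<lambda>x. b / z * ((ln (x / z) + L) ^ r / (1 - b / z * x))) has_integral b / z * (z * I 1 \<alpha>)) {0..z - \<epsilon>}"
      using z by (intro has_integral_mult_right) simp
    \<comment> \<open>The rule \<open>ln (x / z) + ln z = ln x\<close> breaks down at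
      \<open>x = 0\<close>, so that single point is discarded.\<close>
    then have "(F has_integral b / z * (z * I 1 \<alpha>)) {0..z - \<epsilon>}"
    proof (rule has_integral_spike_finite[of "{0}", rotated 2])
      fix x assume "x \<in> {0..z - \<epsilon>} - {0}"
      then show "F x = b / z * ((ln (x / z) + L) ^ r / (1 - b / z * x))"
        using z by (simp add: F_def L_def ln_div)
    qed simp
    then show ?thesis using z by simp
  qed
  have F_cont: "continuous_on {z + \<epsilon>..1} F"
  proof -
    have "1 - b / z * y \<noteq> 0" "y > 0" if "y \<in> {z + \<epsilon>..1}" for y
      using that z \<epsilon> b by (auto simp: divide_simps)
    then show ?thesis unfolding F_def using z \<epsilon> by (intro continuous_intros) auto
  qed
  have above: "integral {z + \<epsilon>..1} F = (L - ln \<beta>) ^ Suc r / real (Suc r) - b * I (-1) \<beta> + b * I (-1) z"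
  proof -
    let ?k = "\<lambda>v. (-1 * ln v + L) ^ r"
    have S: "((\<lambda>v. (- z / v\<^sup>2) *\<^sub>R F (z / v)) has_integral (integral {z / z..z / \<beta>} F - integral {z / \<beta>..z / z} F)) {z..\<beta>}"
    proof (rule has_integral_substitution_general[of "{}"])
      show "(/) z ` {z..\<beta>} \<subseteq> {z + \<epsilon>..1}"
      proof
        fix y assume "y \<in> (/) z ` {z..\<beta>}"
        then obtain v where "v \<in> {z..\<beta>}" and y: "y = z / v" by blast
        then have v: "z \<le> v" "v \<le> \<beta>" "0 < v" using z by auto
        have "v * (z + \<epsilon>) \<le> z" using v z \<epsilon> by (simp add: \<beta>_def divide_simps split: if_splits)
        then show "y \<in> {z + \<epsilon>..1}" using v by (simp add: y pos_le_divide_eq mult.commute)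
      qed
      show "continuous_on {z..\<beta>} ((/) z)" using z by (intro continuous_intros) auto
      show "((/) z has_real_derivative - z / x\<^sup>2) (at x within {z..\<beta>})" if "x \<in> {z..\<beta>} - {}" for x
        using that z by (auto intro!: derivative_eq_intros simp: power2_eq_square)
    qed (use \<beta> F_cont in auto)
    \<comment> \<open>As \<open>v\<close> runs from \<open>z\<close> up to \<open>\<beta>\<close>,
      the variable \<open>z / v\<close> runs from 1 down to \<open>z + \<epsilon>\<close>. Of the
      two oriented integrals, the one over \<open>{1..z + \<epsilon>}\<close> is 0 because
      \<open>z + \<epsilon> < 1\<close>.\<close>
    have "z / \<beta> = z + \<epsilon>" using z \<epsilon> by (simp add: \<beta>_def)
    then have S: "((\<lambda>v. (- z / v\<^sup>2) *\<^sub>R F (z / v)) has_integral (integral {1..z + \<epsilon>} F - integral {z + \<epsilon>..1} F)) {z..\<beta>}"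
      using S z by (simp only: divide_self)
    have eq: "(- z / v\<^sup>2) *\<^sub>R F (z / v) = ?k v / v + b * (?k v / (1 - b * v))" if v: "v \<in> {z..\<beta>}" for v
    proof -
      have v0: "v > 0" "v \<noteq> 1 \<or> b = -1" using v z \<beta> b by auto
      have nb: "1 - b * v \<noteq> 0" "v - b \<noteq> 0" using v0 b by auto
      have "(- z / v\<^sup>2) *\<^sub>R F (z / v) = - b * ?k v / (v * (v - b))"
        using z v0 nb by (simp add: F_def ln_div L_def power2_eq_square) (simp add: field_simps)
      also have "v - b = - b * (1 - b * v)" using bb by (simp add: algebra_simps flip: mult.assoc)
      also have "- b * ?k v / (v * (- b * (1 - b * v))) = ?k v / (v * (1 - b * v))"
        using b by auto
      \<comment> \<open>The part with \<open>1 / v\<close> has an elementary primitive and yields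
        the pure power of the logarithm; the other part has the kernel of the lower piece.\<close>
      also have "\<dots> = ?k v * (1 / v + b / (1 - b * v))" using v0 nb by (simp add: divide_simps)
      finally show ?thesis by (simp add: algebra_simps)
    qed
    have 1: "((\<lambda>v. ?k v / v + b * (?k v / (1 - b * v))) has_integral
        (integral {1..z + \<epsilon>} F - integral {z + \<epsilon>..1} F)) {z..\<beta>}"
      by (rule has_integral_eq[OF eq S])
    have "((\<lambda>v. ?k v / v) has_integral (- ((L - ln \<beta>) ^ Suc r / real (Suc r)) - (- ((L - ln z) ^ Suc r / real (Suc r))))) {z..\<beta>}"
    proof (rule fundamental_theorem_of_calculus)
      show "((\<lambda>v. - ((L - ln v) ^ Suc r / real (Suc r))) has_vector_derivative ?k x / x) (at x within {z..\<beta>})"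
        if "x \<in> {z..\<beta>}" for x
        unfolding has_real_derivative_iff_has_vector_derivative[symmetric]
        using that z by (auto intro!: derivative_eq_intros simp del: of_nat_Suc power_Suc)
    qed (use \<beta> in auto)
    then have 2: "((\<lambda>v. ?k v / v) has_integral - ((L - ln \<beta>) ^ Suc r / real (Suc r))) {z..\<beta>}"
      by (simp add: L_def)
    have "I (-1) z + integral {z..\<beta>} (\<lambda>v. ?k v / (1 - b * v)) = I (-1) \<beta>"
    proof -
      have "(\<lambda>v. ?k v / (1 - b * v)) integrable_on {0..\<beta>}" using I[of \<beta> "-1"] \<beta> by auto
      from Henstock_Kurzweil_Integration.integral_combine[OF _ _ this, of z] show ?thesis
        using integral_unique[OF I[of z "-1"]] integral_unique[OF I[of \<beta> "-1"]] z \<beta> by simp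
    qed
    moreover have "(\<lambda>v. ?k v / (1 - b * v)) integrable_on {z..\<beta>}"
      by (rule integrable_on_subinterval[of _ "{0..\<beta>}"]) (use I[of \<beta> "-1"] \<beta> z in auto)
    ultimately have "((\<lambda>v. ?k v / (1 - b * v)) has_integral I (-1) \<beta> - I (-1) z) {z..\<beta>}"
      by (simp add: has_integral_iff)
    from has_integral_unique[OF 1 has_integral_add[OF 2 has_integral_mult_right[OF this, of b]]]
    have "integral {1..z + \<epsilon>} F - integral {z + \<epsilon>..1} F
        = - ((L - ln \<beta>) ^ Suc r / real (Suc r)) + b * (I (-1) \<beta> - I (-1) z)" .
    moreover have "integral {1..z + \<epsilon>} F = 0" using \<epsilon> by simp
    ultimately show ?thesis by (simp add: algebra_simps)
  qed
  \<comment> \<open>The leftover over \<open>{0..z}\<close> is the polylogarithm at the inverse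
    point: for \<open>v = z * x\<close> the base \<open>ln z - ln v\<close> becomes
    \<open>- ln x\<close>.\<close>
  have Li: "fact r * Li (Suc r) (b * z) = b * I (-1) z"
  proof -
    have "((\<lambda>x. (-1 * ln (z * x) + L) ^ r / (1 - b * (z * x))) has_integral (1 / \<bar>z\<bar>) *\<^sub>R I (-1) z)
        ((\<lambda>x. x / z) ` {0..z})"
      by (rule has_integral_stretch_real[OF I]) (use z in auto)
    moreover have "(\<lambda>x. x / z) ` {0..z} = {0..1}"
    proof -
      have "(\<lambda>x. x / z) = (*) (1 / z)" by auto
      then show ?thesis using z image_mult_atLeastAtMost[of "1 / z" 0 z] by simp
    qed
    ultimately have "((\<lambda>x. b * z * (-1) ^ r * ((-1 * ln (z * x) + L) ^ r / (1 - b * (z * x)))) has_integral b * z * (-1) ^ r * (1 / z * I (-1) z)) {0..1}"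
      using z by (intro has_integral_mult_right) simp
    then have "((\<lambda>x. b * z * ln x ^ r / (1 - b * z * x)) has_integral b * z * (-1) ^ r * (1 / z * I (-1) z)) {0..1}"
    proof (rule has_integral_spike_finite[of "{0}", rotated 2])
      fix x :: real assume "x \<in> {0..1} - {0}"
      then have "-1 * ln (z * x) + L = (-1) * ln x" using z by (simp add: L_def ln_mult)
      then show "b * z * ln x ^ r / (1 - b * z * x) = b * z * (-1) ^ r * ((-1 * ln (z * x) + L) ^ r / (1 - b * (z * x)))"
        by (simp only: power_mult_distrib) (simp add: mult.assoc)
    qed simp
    then have "integral {0..1} (\<lambda>x. b * z * ln x ^ r / (1 - b * z * x)) = b * z * (-1) ^ r * (1 / z * I (-1) z)"
      by (rule integral_unique)
    moreover have "b * z \<le> 1" using b z by auto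
    ultimately show ?thesis using z by (simp add: Li_def)
  qed
  show "F integrable_on {0..z - \<epsilon>}" using below by blast
  show "F integrable_on {z + \<epsilon>..1}" by (rule integrable_continuous_real[OF F_cont])
  have "I 1 \<alpha> - I (-1) \<beta> = (\<Sum>j\<le>r. real (r choose j) * L ^ (r - j) * (J j \<alpha> - (-1) ^ j * J j \<beta>))"
    unfolding I_def sum_subtractf[symmetric] by (intro sum.cong refl) (simp add: algebra_simps)
  then show "integral {0..z - \<epsilon>} F + integral {z + \<epsilon>..1} F
      = b * (\<Sum>j\<le>r. real (r choose j) * ln z ^ (r - j) * (J j (1 - \<epsilon> / z) - (-1) ^ j * J j (z / (z + \<epsilon>))))
        + fact r * Li (Suc r) (b * z) + (ln z - ln (z / (z + \<epsilon>))) ^ Suc r / real (Suc r)"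
    unfolding integral_unique[OF below] above Li L_def[symmetric] \<alpha>_def[symmetric] \<beta>_def[symmetric]
    by (simp add: algebra_simps del: power_Suc)
qed

text \<open>As \<open>\<epsilon>\<close> tends to 0 both upper limits tend to 1, and
  \<open>J j 1 - (-1) ^ j * J j 1\<close> retains only odd \<open>j\<close>. For
  \<open>b = 1\<close> the term \<open>j = 0\<close> diverges on each side of the pole, and only the
  symmetric excision makes its logarithms cancel.\<close>

lemma Li_inversion_log_kernel:
  fixes b z :: real
  assumes b: "b \<in> {1, -1}" and z: "0 < z" "z < 1"
  defines "J \<equiv> \<lambda>j t. integral {0..t} (\<lambda>u. ln u ^ j / (1 - b * u))"
  shows "Li (Suc r) (b / z) = (-1) ^ r / fact r *
    (b * (\<Sum>j\<le>r. real (r choose j) * ln z ^ (r - j) * (if odd j then 2 * J j 1 else 0))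
        + fact r * Li (Suc r) (b * z) + ln z ^ Suc r / real (Suc r))" (is "_ = _ * ?E")
proof -
  let ?F = "\<lambda>y. b / z * ln y ^ r / (1 - b / z * y)"
  show ?thesis
  proof (cases "b = 1")
    \<comment> \<open>The pole lies at \<open>y = b * z < 0\<close>, outside the interval, so
      \<open>\<epsilon> = 0\<close> is admissible and no limit is taken.\<close>
    case False
    then have b': "b = -1" using b by auto
    have T: "?F integrable_on {0..z}" "?F integrable_on {z..1}"
      using Li_inversion_truncated(1,2)[OF b z, of 0 r] z b' by auto
    have "integral {0..z - 0} ?F + integral {z + 0..1} ?F
      = b * (\<Sum>j\<le>r. real (r choose j) * ln z ^ (r - j) * (J j (1 - 0 / z) - (-1) ^ j * J j (z / (z + 0))))
        + fact r * Li (Suc r) (b * z) + (ln z - ln (z / (z + 0))) ^ Suc r / real (Suc r)"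
      unfolding J_def by (rule Li_inversion_truncated(3)[OF b z]) (use z b' in auto)
    moreover have "J j 1 - (-1) ^ j * J j 1 = (if odd j then 2 * J j 1 else 0)" for j by simp
    moreover have "1 - 0 / z = 1" "z / (z + 0) = 1" "z - 0 = z" "z + 0 = z" using z by auto
    ultimately have "integral {0..z} ?F + integral {z..1} ?F = ?E"
      by (simp only: ln_one diff_zero)
    moreover have "integral {0..z} ?F + integral {z..1} ?F = integral {0..1} ?F"
    proof (rule Henstock_Kurzweil_Integration.integral_combine)
      show "?F integrable_on {0..1}"
        by (rule Henstock_Kurzweil_Integration.integrable_combine[of 0 z 1]) (use T z in auto)
    qed (use z in auto)
    moreover have "b / z \<le> 1" using b' z by (simp add: divide_simps)
    ultimately show ?thesis by (simp add: Li_def)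
  next
    case True
    let ?T = "\<lambda>\<epsilon>. integral {0..z - \<epsilon>} ?F + integral {z + \<epsilon>..1} ?F"
    let ?S = "\<lambda>\<epsilon>. b * (\<Sum>j\<le>r. real (r choose j) * ln z ^ (r - j) * (J j (1 - \<epsilon> / z) - (-1) ^ j * J j (z / (z + \<epsilon>))))
        + fact r * Li (Suc r) (b * z) + (ln z - ln (z / (z + \<epsilon>))) ^ Suc r / real (Suc r)"
    have small: "\<forall>\<^sub>F \<epsilon> in at_right 0. 0 < \<epsilon> \<and> \<epsilon> < z \<and> \<epsilon> < 1 - z"
      using z eventually_at_right_real[of 0 "min z (1 - z)"] by (auto elim!: eventually_mono)
    have \<alpha>: "((\<lambda>\<epsilon>. 1 - \<epsilon> / z) \<longlongrightarrow> 1) (at_right 0)" using z by (auto intro!: tendsto_eq_intros)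
    have \<beta>: "((\<lambda>\<epsilon>. z / (z + \<epsilon>)) \<longlongrightarrow> 1) (at_right 0)" using z by (auto intro!: tendsto_eq_intros)
    have Jlim: "((\<lambda>\<epsilon>. J j (g \<epsilon>)) \<longlongrightarrow> J j 1) (at_right 0)"
      if "j > 0" "(g \<longlongrightarrow> 1) (at_right 0)" "\<forall>\<^sub>F \<epsilon> in at_right 0. g \<epsilon> \<in> {0..1}" for j g
    proof -
      have "continuous_on {0..1} (J j)"
        unfolding J_def by (intro indefinite_integral_continuous_1 log_kernel_integrable) (use b that in auto)
      from continuous_on_tendsto_compose[OF this that(2) _ that(3)] show ?thesis by simp
    qed
    have J0: "J 0 t = - ln (1 - t)" if "0 \<le> t" "t < 1" for t
    proof -
      have "((\<lambda>u. 1 / (1 - u)) has_integral (- ln (1 - t) - (- ln (1 - 0)))) {0..t}"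
      proof (rule fundamental_theorem_of_calculus)
        show "((\<lambda>u. - ln (1 - u)) has_vector_derivative 1 / (1 - x)) (at x within {0..t})" if "x \<in> {0..t}" for x
          unfolding has_real_derivative_iff_has_vector_derivative[symmetric]
          using that \<open>t < 1\<close> by (auto intro!: derivative_eq_intros)
      qed (use that in auto)
      then show ?thesis by (simp add: J_def True integral_unique)
    qed
    have "((\<lambda>\<epsilon>. J j (1 - \<epsilon> / z) - (-1) ^ j * J j (z / (z + \<epsilon>))) \<longlongrightarrow> (if odd j then 2 * J j 1 else 0)) (at_right 0)" for j
    proof (cases "j = 0")
      case True
      \<comment> \<open>The divergent parts are \<open>- ln (\<epsilon> / z)\<close> and
        \<open>- ln (\<epsilon> / (z + \<epsilon>))\<close>; in their difference
        \<open>ln \<epsilon>\<close> disappears.\<close>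
      have "((\<lambda>\<epsilon>. ln (z / (z + \<epsilon>))) \<longlongrightarrow> ln 1) (at_right 0)" by (intro tendsto_ln \<beta>) auto
      moreover have "\<forall>\<^sub>F \<epsilon> in at_right 0. ln (z / (z + \<epsilon>)) = J 0 (1 - \<epsilon> / z) - (-1) ^ 0 * J 0 (z / (z + \<epsilon>))"
        using small
      proof eventually_elim
        case (elim \<epsilon>)
        have 1: "J 0 (1 - \<epsilon> / z) = - ln (\<epsilon> / z)" using J0[of "1 - \<epsilon> / z"] elim z by simp
        have "1 - z / (z + \<epsilon>) = \<epsilon> / (z + \<epsilon>)" using elim z by (simp add: field_simps)
        then have 2: "J 0 (z / (z + \<epsilon>)) = - ln (\<epsilon> / (z + \<epsilon>))" using J0[of "z / (z + \<epsilon>)"] elim z by simp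
        show ?case unfolding 1 2 using elim z by (simp add: ln_div)
      qed
      ultimately show ?thesis using True by (simp add: tendsto_cong)
    next
      case False
      have "((\<lambda>\<epsilon>. J j (1 - \<epsilon> / z) - (-1) ^ j * J j (z / (z + \<epsilon>))) \<longlongrightarrow> J j 1 - (-1) ^ j * J j 1) (at_right 0)"
      proof (intro tendsto_diff tendsto_mult tendsto_const Jlim \<alpha> \<beta>)
        show "\<forall>\<^sub>F \<epsilon> in at_right 0. 1 - \<epsilon> / z \<in> {0..1}" using small by eventually_elim (use z in auto)
        show "\<forall>\<^sub>F \<epsilon> in at_right 0. z / (z + \<epsilon>) \<in> {0..1}" using small by eventually_elim (use z in auto)
      qed (use False in auto)
      then show ?thesis by (cases "even j") auto
    qed
    then have "(?S \<longlongrightarrow> b * (\<Sum>j\<le>r. real (r choose j) * ln z ^ (r - j) * (if odd j then 2 * J j 1 else 0))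
        + fact r * Li (Suc r) (b * z) + (ln z - ln 1) ^ Suc r / real (Suc r)) (at_right 0)"
      by (intro tendsto_intros \<beta>) auto
    then have "(?S \<longlongrightarrow> ?E) (at_right 0)" by simp
    moreover have "\<forall>\<^sub>F \<epsilon> in at_right 0. ?S \<epsilon> = ?T \<epsilon>"
      using small
    proof eventually_elim
      case (elim \<epsilon>)
      show ?case unfolding J_def by (rule Li_inversion_truncated(3)[OF b z, symmetric]) (use elim in auto)
    qed
    ultimately have "(?T \<longlongrightarrow> ?E) (at_right 0)" by (rule Lim_transform_eventually)
    then have "pv_integral 0 z 1 ?F = ?E"
      unfolding pv_integral_def by (rule tendsto_Lim[OF trivial_limit_at_right_real])
    moreover have "1 < b / z" using True z by simp
    ultimately show ?thesis using True by (simp add: Li_def)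
  qed
qed

text \<open>Expanding the kernel gives \<open>J j = - fact j * Lerch b (Suc j) 1\<close> for odd
  \<open>j\<close>, so the surviving indices are \<open>Suc j = 2 * k\<close>, and
  \<open>real (r choose j) * fact j\<close> reduces to
  \<open>fact r / fact (p - 2 * k)\<close>.\<close>

lemma Li_inversion:
  fixes b z :: real
  assumes p: "p > 0" and b: "b \<in> {1, -1}" and z: "0 < z" "z < 1"
  shows "Li p (b / z) = (-1) ^ (p - 1) * Li p (b * z)
    + 2 * (-1) ^ p * (\<Sum>k = 0..p div 2. b * Lerch b (2 * k) 1 * ln z ^ (p - 2 * k) / fact (p - 2 * k))"
proof -
  obtain r where r: "p = Suc r" using p by (cases p) auto
  define J where "J = (\<lambda>j. integral {0..1} (\<lambda>u. ln u ^ j / (1 - b * u)))"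
  define f where "f = (\<lambda>k. b * Lerch b k 1 * ln z ^ (p - k) / fact (p - k))"
  have J: "J j = - fact j * Lerch b (Suc j) 1" if "odd j" for j
  proof -
    have "(\<lambda>k. (-1) ^ j * fact j * b ^ k / real (0 + 1 * k + 1) ^ Suc j) sums
      integral {0<..<1} (\<lambda>x. x ^ 0 * ln x ^ j / (1 - b * x ^ 1))"
      by (rule log_geometric_integral_sums) (use b that in \<open>auto elim: oddE\<close>)
    then have "(\<lambda>k. - fact j * (b ^ k / (real k + 1) ^ Suc j)) sums J j"
      using that by (simp add: J_def integral_open_interval_real add.commute)
    moreover have "(\<lambda>k. - fact j * (b ^ k / (real k + 1) ^ Suc j)) sums (- fact j * Lerch b (Suc j) 1)"
      by (intro sums_mult Lerch_sums) (use b that in \<open>auto elim: oddE\<close>)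
    ultimately show ?thesis by (rule sums_unique2)
  qed
  have "b * (\<Sum>j\<le>r. real (r choose j) * ln z ^ (r - j) * (if odd j then 2 * J j else 0))
      = (\<Sum>j\<le>r. - 2 * fact r * (if even (Suc j) then f (Suc j) else 0))"
    unfolding sum_distrib_left
  proof (intro sum.cong refl)
    fix j assume "j \<in> {..r}"
    then have "real (r choose j) * fact j = fact r / fact (r - j)"
      by (simp add: binomial_fact)
    then show "b * (real (r choose j) * ln z ^ (r - j) * (if odd j then 2 * J j else 0))
      = - 2 * fact r * (if even (Suc j) then f (Suc j) else 0)"
      using J[of j] by (simp add: f_def r field_simps)
  qed
  also have "\<dots> = - 2 * fact r * (\<Sum>k = 1..p div 2. f (2 * k))"
  proof -
    have "(\<Sum>j\<le>r. if even (Suc j) then f (Suc j) else 0) = (\<Sum>j \<in> (\<lambda>k. 2 * k - 1) ` {1..p div 2}. if even (Suc j) then f (Suc j) else 0)"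
    proof (rule sum.mono_neutral_right)
      show "(\<lambda>k. 2 * k - 1) ` {1..p div 2} \<subseteq> {..r}" by (auto simp: r)
      show "\<forall>j\<in>{..r} - (\<lambda>k. 2 * k - 1) ` {1..p div 2}. (if even (Suc j) then f (Suc j) else 0) = 0"
      proof
        fix j assume j: "j \<in> {..r} - (\<lambda>k. 2 * k - 1) ` {1..p div 2}"
        have "odd (Suc j)"
        proof
          assume "even (Suc j)"
          then obtain k where k: "Suc j = 2 * k" by (elim evenE)
          then have "j = 2 * k - 1" "k \<in> {1..p div 2}" using j by (auto simp: r)
          then show False using j by blast
        qed
        then show "(if even (Suc j) then f (Suc j) else 0) = 0" by simp
      qed
    qed auto
    also have "\<dots> = (\<Sum>k = 1..p div 2. f (2 * k))"
      by (subst sum.reindex) (auto simp: inj_on_def intro!: sum.cong)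
    finally show ?thesis by (simp only: sum_distrib_left[symmetric])
  qed
  finally have "Li p (b / z) = (-1) ^ r / fact r * (- 2 * fact r * (\<Sum>k = 1..p div 2. f (2 * k))
        + fact r * Li p (b * z) + ln z ^ p / real p)"
    using Li_inversion_log_kernel[OF b z, of r] by (simp only: r J_def)
  \<comment> \<open>\<open>b * Lerch b 0 1 = -1/2\<close> for either sign, so the elementary term
    supplies exactly the missing index \<open>k = 0\<close>.\<close>
  also have "ln z ^ p / real p = - 2 * fact r * f 0"
    using b by (auto simp: f_def Lerch_def r)
  also have "(-1) ^ r / fact r * (- 2 * fact r * (\<Sum>k = 1..p div 2. f (2 * k)) + fact r * Li p (b * z) + - 2 * fact r * f 0)
      = (-1) ^ r * Li p (b * z) + 2 * (-1) ^ p * (f (2 * 0) + (\<Sum>k = 1..p div 2. f (2 * k)))"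
    by (simp add: r field_simps)
  also have "f (2 * 0) + (\<Sum>k = 1..p div 2. f (2 * k)) = (\<Sum>k = 0..p div 2. f (2 * k))"
    by (simp add: sum.atLeast_Suc_atMost)
  finally show ?thesis by (simp add: f_def r)
qed

section \<open>The two integrals\<close>

lemma log_over_quadratic_has_integral:
  fixes a :: real
  assumes "a \<in> {1, -1}" "a = 1 \<longrightarrow> s > 0"
  shows "((\<lambda>x. ln x ^ s / (1 - a * x\<^sup>2)) has_integral (-1) ^ s * fact s * (Lerch a (Suc s) (1/2) / 2 ^ Suc s)) {0<..<1}"
proof -
  have hyp: "\<bar>a\<bar> \<le> 1" "a = 1 \<longrightarrow> s > 0" "(2::nat) > 0" using assms by auto
  have "(\<lambda>k. (-1) ^ s * fact s * a ^ k / real (0 + 2 * k + 1) ^ Suc s) sums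
      integral {0<..<1} (\<lambda>x. x ^ 0 * ln x ^ s / (1 - a * x ^ 2))"
    by (rule log_geometric_integral_sums[OF hyp])
  moreover have "(\<lambda>k. (-1) ^ s * fact s * (a ^ k / (2 * real k + 1) ^ Suc s)) sums ((-1) ^ s * fact s * (Lerch a (Suc s) (1/2) / 2 ^ Suc s))"
    by (intro sums_mult odd_series_tail(1)) (use assms in auto)
  moreover have "(\<lambda>k. (-1) ^ s * fact s * a ^ k / real (0 + 2 * k + 1) ^ Suc s) = (\<lambda>k. (-1) ^ s * fact s * (a ^ k / (2 * real k + 1) ^ Suc s))"
    by (simp add: add.commute)
  ultimately have "integral {0<..<1} (\<lambda>x. x ^ 0 * ln x ^ s / (1 - a * x ^ 2)) = (-1) ^ s * fact s * (Lerch a (Suc s) (1/2) / 2 ^ Suc s)"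
    by (simp only: sums_unique2)
  moreover have "(\<lambda>x. x ^ 0 * ln x ^ s / (1 - a * x ^ 2)) integrable_on {0<..<1}"
    using log_geometric_absolutely_integrable[OF hyp, of 0] by (simp add: absolutely_integrable_on_def)
  ultimately show ?thesis by (simp add: has_integral_iff)
qed

theorem theorem4:
  fixes p q n :: nat and a b :: real
  assumes "p > 0" and "q > 0" and "n > 0"
    and "b \<in> {1, -1}"
    and "a = (-1) ^ (p + q - 1)"
    and "a ^ n * b = 1 \<longrightarrow> p \<noteq> 1"
    and "a = 1 \<longrightarrow> q \<noteq> 1"
  shows
    "((\<lambda>x. ln x ^ (q - 1) * Li p (b * x ^ (2 * n)) / (1 - a * x\<^sup>2)) has_integral
       (- (1 / 2) * a ^ (n - 1) * b * 2 powi (- int q) * fact (q - 1) * (1 - (-1) ^ p)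
            * Lerch a q (1 / 2) * Lerch (a ^ n * b) p 1
        + a * b * 2 powi (- int q) * real n ^ p * fact (q - 1)
            * (\<Sum>k = 0..p div 2. real ((p + q - 2 * k - 1) choose (q - 1))
                 * real n powi (- 2 * int k) * Lerch b (2 * k) 1
                 * Lerch a (p + q - 2 * k) (1 / 2))
        + 1 / 2 * a ^ (n - 1) * b * (2 * real n) powi (- int q) * fact (q - 1)
            * (\<Sum>j = 1..n. \<Sum>k = 1..q. real ((p + q - k - 1) choose (p - 1))
                 * a ^ j * (-1) ^ k * Theta b k (2 * real j - 1) (2 * real n)
                 * Lerch (a ^ n * b) (p + q - k)
                     ((2 * real n - 2 * real j + 1) / (2 * real n))))) {0<..<1}
     \<and>
     ((\<lambda>x. ln x ^ (q - 1) * Li p (b * x powi (- 2 * int n)) / (1 - a * x\<^sup>2)) has_integral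
       (- (1 / 2) * a ^ n * b * (-2) powi (- int q) * fact (q - 1) * (1 - (-1) ^ p)
            * Lerch a q (1 / 2) * Lerch (a ^ n * b) p 1
        - b * (-2) powi (- int q) * real n ^ p * fact (q - 1)
            * (\<Sum>k = 0..p div 2. real ((p + q - 2 * k - 1) choose (q - 1))
                 * real n powi (- 2 * int k) * Lerch b (2 * k) 1
                 * Lerch a (p + q - 2 * k) (1 / 2))
        + 1 / 2 * a ^ n * b * (- 2 * real n) powi (- int q) * fact (q - 1)
            * (\<Sum>j = 1..n. \<Sum>k = 1..q. real ((p + q - k - 1) choose (p - 1))
                 * a ^ j * (-1) ^ k * Theta b k (2 * real j - 1) (2 * real n)
                 * Lerch (a ^ n * b) (p + q - k)
                     ((2 * real n - 2 * real j + 1) / (2 * real n))))) {0<..<1}"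
proof -
  have a1: "a \<in> {1, -1}" using assms(5) by (auto simp: minus_one_power_iff)
  obtain p' q' n' where Suc: "p = Suc p'" "q = Suc q'" "n = Suc n'"
    using assms(1-3) by (metis gr0_conv_Suc)
  have aa: "a * a = 1" using a1 by auto
  have an: "a ^ n = a * a ^ (n - 1)" by (simp add: Suc)
  \<comment> \<open>Three forms of the parity hypothesis. The first is the sign left by
    \<open>(-1) ^ (q - 1)\<close> from the logarithmic integral together with that of
    \<open>(- 2 * real n) ^ p\<close> from the partial fractions.\<close>
  have sgn: "(-1) ^ (q - 1) * (-1) ^ p = a" "(-1) ^ p * a = - ((-1) ^ q)" "(-1) ^ q * a = - ((-1) ^ p)"
    using assms(5) by (auto simp: Suc power_add minus_one_power_iff)
  define c where "c = a ^ n * b"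
  define T1 where "T1 = a ^ (n - 1) * b / 2 ^ q * fact (q - 1) * (1 - (-1) ^ p) * Lerch a q (1 / 2) * Lerch c p 1"
  define \<Sigma>2 where "\<Sigma>2 = (\<Sum>k = 0..p div 2. real ((p + q - 2 * k - 1) choose (q - 1))
                 * real n powi (- 2 * int k) * Lerch b (2 * k) 1
                 * Lerch a (p + q - 2 * k) (1 / 2))"
  define T2 where "T2 = b / 2 ^ q * real n ^ p * fact (q - 1) * \<Sigma>2"
  define \<Sigma>3 where "\<Sigma>3 = (\<Sum>j = 1..n. \<Sum>k = 1..q. real ((p + q - k - 1) choose (p - 1))
                 * a ^ j * (-1) ^ k * Theta b k (2 * real j - 1) (2 * real n)
                 * Lerch c (p + q - k) ((2 * real n - 2 * real j + 1) / (2 * real n)))"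
  define T3 where "T3 = a ^ (n - 1) * b / (2 * real n) ^ q * fact (q - 1) * \<Sigma>3"
  \<comment> \<open>Both right-hand sides are combinations of the same three blocks, so the second
    identity can be read off from the first by signs.\<close>
  define V1 where "V1 = - (1/2) * T1 + a * T2 + 1/2 * T3"
  let ?f = "\<lambda>x. ln x ^ (q - 1) * Li p (b * x ^ (2 * n)) / (1 - a * x\<^sup>2)"
  let ?g = "\<lambda>x. ln x ^ (q - 1) * Li p (b * x powi (- 2 * int n)) / (1 - a * x\<^sup>2)"
  have powi_n: "real n powi (- 2 * int k) = 1 / real n ^ (2 * k)" for k
  proof -
    have "- 2 * int k = - int (2 * k)" by simp
    then show ?thesis by (simp only: power_int_minus power_int_of_nat inverse_eq_divide)
  qed
  have f: "(?f has_integral V1) {0<..<1}"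
  proof -
    note log_Li_integral[OF assms(1-4) a1 assms(7) double_series_value[OF assms], folded c_def]
    moreover have "(-1) ^ (q - 1) * fact (q - 1) *
      (1 / 2 * ((1 - (-1) ^ p) * (Lerch a q (1/2) / 2 ^ q) * (c * Lerch c p 1))) = - (1/2) * T1"
    \<comment> \<open>For even \<open>p\<close> both sides vanish through
      \<open>1 - (-1) ^ p\<close>; for odd \<open>p\<close> the sign \<open>(-1) ^ (q - 1)\<close>
      equals \<open>- a\<close>.\<close>
    proof (cases "even p")
      case True
      then show ?thesis by (simp add: T1_def)
    next
      case False
      then have "(-1) ^ (q - 1) = - a" using sgn(1) by simp
      then have "(-1) ^ (q - 1) * a = -1" using aa by simp
      moreover have "(-1) ^ (q - 1) * c = ((-1) ^ (q - 1) * a) * (a ^ (n - 1) * b)"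
        by (simp add: c_def an)
      ultimately have "(-1) ^ (q - 1) * c = - (a ^ (n - 1) * b)" by simp
      moreover have "(-1) ^ (q - 1) * fact (q - 1) * (1 / 2 * ((1 - (-1) ^ p) * (Lerch a q (1/2) / 2 ^ q) * (c * Lerch c p 1)))
        = ((-1) ^ (q - 1) * c) * (fact (q - 1) * (1 / 2) * (1 - (-1) ^ p) * (Lerch a q (1/2) / 2 ^ q) * Lerch c p 1)"
        by (simp only: mult_ac)
      ultimately show ?thesis unfolding T1_def by simp
    qed
    moreover have "(-1) ^ (q - 1) * fact (q - 1) * (1 / 2 * ((- 2 * real n) ^ p *
      (\<Sum>k = 0..p div 2. real ((p + q - 2 * k - 1) choose (q - 1)) * (2 * b * Lerch b (2 * k) 1 / (2 * real n) ^ (2 * k))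
          * (Lerch a (p + q - 2 * k) (1/2) / 2 ^ (p + q - 2 * k))))) = a * T2"
    proof -
      have "(-1) ^ (q - 1) * fact (q - 1) * (1 / 2 * ((- 2 * real n) ^ p *
        (real ((p + q - 2 * k - 1) choose (q - 1)) * (2 * b * Lerch b (2 * k) 1 / (2 * real n) ^ (2 * k))
          * (Lerch a (p + q - 2 * k) (1/2) / 2 ^ (p + q - 2 * k)))))
        = a * (b / 2 ^ q * real n ^ p * fact (q - 1) * (real ((p + q - 2 * k - 1) choose (q - 1))
                 * real n powi (- 2 * int k) * Lerch b (2 * k) 1 * Lerch a (p + q - 2 * k) (1 / 2)))"
        if "k \<in> {0..p div 2}" for k
      proof -
        have "2 * k + (p + q - 2 * k) = p + q" using that by auto
        then have two: "(2::real) ^ (2 * k) * 2 ^ (p + q - 2 * k) = 2 ^ p * 2 ^ q" by (simp flip: power_add)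
        define t :: real where "t = 2 ^ (p + q - 2 * k)"
        define u :: real where "u = 2 ^ (2 * k)"
        have ut: "2 ^ p * 2 ^ q = u * t" "u > 0" "t > 0" using two by (auto simp: u_def t_def)
        have "(2::real) ^ p / (u * t) = 1 / 2 ^ q" using ut by (simp add: field_simps)
        moreover have "(- 2 * real n) ^ p = (-1) ^ p * 2 ^ p * real n ^ p"
          by (simp flip: power_mult_distrib)
        moreover have "(2 * real n) ^ (2 * k) = u * real n ^ (2 * k)" by (simp only: u_def power_mult_distrib)
        moreover have "s1 * F * (1 / 2 * ((s2 * P * N) * (C * (2 * b * L / (u * E)) * (L' / t))))
            = (s1 * s2) * ((P / (u * t)) * (b * N * F * (C * (1 / E) * L * L')))" for s1 s2 F P N C L L' E :: real
          by (simp add: mult_ac)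
        ultimately have "(-1) ^ (q - 1) * fact (q - 1) * (1 / 2 * ((- 2 * real n) ^ p *
          (real ((p + q - 2 * k - 1) choose (q - 1)) * (2 * b * Lerch b (2 * k) 1 / (2 * real n) ^ (2 * k))
          * (Lerch a (p + q - 2 * k) (1/2) / t))))
          = ((-1) ^ (q - 1) * (-1) ^ p) * ((2 ^ p / (u * t)) * (b * real n ^ p * fact (q - 1) * (real ((p + q - 2 * k - 1) choose (q - 1))
                 * (1 / real n ^ (2 * k)) * Lerch b (2 * k) 1 * Lerch a (p + q - 2 * k) (1 / 2))))"
          by (simp only:)
        also have "\<dots> = a * (b / 2 ^ q * real n ^ p * fact (q - 1) * (real ((p + q - 2 * k - 1) choose (q - 1))
                 * real n powi (- 2 * int k) * Lerch b (2 * k) 1 * Lerch a (p + q - 2 * k) (1 / 2)))"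
          unfolding sgn(1) \<open>2 ^ p / (u * t) = 1 / 2 ^ q\<close> powi_n by simp
        finally show ?thesis unfolding t_def .
      qed
      then show ?thesis unfolding T2_def \<Sigma>2_def sum_distrib_left by (intro sum.cong refl) auto
    qed
    moreover have "(-1) ^ (q - 1) * fact (q - 1) * (1 / 2 * ((- 2 * real n) ^ p *
      (\<Sum>j<n. \<Sum>k = 1..q. real ((p + q - k - 1) choose (p - 1)) * (Theta b k (2 * real j + 1) (2 * real n) / (2 * real n) ^ k)
          * (a ^ j * (Lerch c (p + q - k) ((2 * real j + 1) / (2 * real n)) / (2 * real n) ^ (p + q - k)))))) = 1/2 * T3"
    proof -
      have "(\<Sum>j<n. \<Sum>k = 1..q. real ((p + q - k - 1) choose (p - 1)) * (Theta b k (2 * real j + 1) (2 * real n) / (2 * real n) ^ k)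
          * (a ^ j * (Lerch c (p + q - k) ((2 * real j + 1) / (2 * real n)) / (2 * real n) ^ (p + q - k))))
        = (\<Sum>j = 1..n. \<Sum>k = 1..q. a ^ n * b / (2 * real n) ^ (p + q) * (real ((p + q - k - 1) choose (p - 1))
                 * a ^ j * (-1) ^ k * Theta b k (2 * real j - 1) (2 * real n)
                 * Lerch c (p + q - k) ((2 * real n - 2 * real j + 1) / (2 * real n))))"
      \<comment> \<open>Replacing \<open>j\<close> by \<open>n - j\<close> passes from the classes
        \<open>0..n - 1\<close> to the indices \<open>1..n\<close>. The signs \<open>a ^ n\<close>
        and \<open>b * (-1) ^ k\<close> come from this reversal, the latter through
        \<open>Theta_reflect\<close>.\<close>
      proof (rule sum.reindex_bij_witness[of _ "\<lambda>j. n - j" "\<lambda>j. n - j"])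
        fix j assume j: "j \<in> {..<n}"
        then have rj: "real (n - j) = real n - real j" by (simp add: of_nat_diff)
        have "2 * real n - 2 * real (n - j) + 1 = 2 * real j + 1" by (simp add: rj)
        moreover have "a ^ n * a ^ (n - j) = a ^ j"
        proof -
          have "a ^ n = a ^ j * a ^ (n - j)" using j by (simp flip: power_add)
          moreover have "a ^ (n - j) * a ^ (n - j) = 1" using aa by (simp flip: power_mult_distrib)
          ultimately show ?thesis by simp
        qed
        moreover have "b * (-1) ^ k * Theta b k (2 * real (n - j) - 1) (2 * real n) = Theta b k (2 * real j + 1) (2 * real n)" for k
        proof -
          have "2 * real n - (2 * real (n - j) - 1) = 2 * real j + 1" by (simp add: rj)
          then show ?thesis using Theta_reflect[OF assms(4), of "2 * real n" k "2 * real (n - j) - 1"] assms(3) by simp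
        qed
        moreover have "(2 * real n) ^ (p + q) = (2 * real n) ^ k * (2 * real n) ^ (p + q - k)" if "k \<in> {1..q}" for k
        proof -
          have "p + q = k + (p + q - k)" using that by simp
          then have "(2 * real n) ^ (p + q) = (2 * real n) ^ (k + (p + q - k))" by (rule arg_cong)
          then show ?thesis by (simp only: power_add)
        qed
        ultimately show "(\<Sum>k = 1..q. a ^ n * b / (2 * real n) ^ (p + q) * (real ((p + q - k - 1) choose (p - 1))
                 * a ^ (n - j) * (-1) ^ k * Theta b k (2 * real (n - j) - 1) (2 * real n)
                 * Lerch c (p + q - k) ((2 * real n - 2 * real (n - j) + 1) / (2 * real n))))
            = (\<Sum>k = 1..q. real ((p + q - k - 1) choose (p - 1)) * (Theta b k (2 * real j + 1) (2 * real n) / (2 * real n) ^ k)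
          * (a ^ j * (Lerch c (p + q - k) ((2 * real j + 1) / (2 * real n)) / (2 * real n) ^ (p + q - k))))"
        proof (intro sum.cong refl, goal_cases)
          case (1 k)
          have "x * b / D * (C * y * \<sigma> * T * L) = 1 / D * C * (x * y) * (b * \<sigma> * T) * L"
            for x y D C \<sigma> T L :: real by simp
          then have "a ^ n * b / (2 * real n) ^ (p + q) * (real ((p + q - k - 1) choose (p - 1))
                 * a ^ (n - j) * (-1) ^ k * Theta b k (2 * real (n - j) - 1) (2 * real n)
                 * Lerch c (p + q - k) ((2 * real n - 2 * real (n - j) + 1) / (2 * real n)))
            = 1 / (2 * real n) ^ (p + q) * real ((p + q - k - 1) choose (p - 1))
                 * (a ^ n * a ^ (n - j)) * (b * (-1) ^ k * Theta b k (2 * real (n - j) - 1) (2 * real n))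
                 * Lerch c (p + q - k) ((2 * real n - 2 * real (n - j) + 1) / (2 * real n))"
            .
          moreover have "1 / (K * K') * C * y * T * L = C * (T / K) * (y * (L / K'))"
            for K K' C y T L :: real by simp
          ultimately show ?case unfolding 1(1-3) 1(4)[OF 1(5)] by (simp only:)
        qed
      qed auto
      also have "\<dots> = a ^ n * b / (2 * real n) ^ (p + q) * \<Sigma>3"
        by (simp only: \<Sigma>3_def sum_distrib_left)
      finally have *: "(\<Sum>j<n. \<Sum>k = 1..q. real ((p + q - k - 1) choose (p - 1)) * (Theta b k (2 * real j + 1) (2 * real n) / (2 * real n) ^ k)
          * (a ^ j * (Lerch c (p + q - k) ((2 * real j + 1) / (2 * real n)) / (2 * real n) ^ (p + q - k)))) = \<dots>" .
      have "(- 2 * real n) ^ p = (-1) ^ p * (2 * real n) ^ p"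
        unfolding power_minus[of "2 * real n" p, symmetric] by simp
      then have "(-1) ^ (q - 1) * fact (q - 1) * (1 / 2 * ((- 2 * real n) ^ p * (a ^ n * b / (2 * real n) ^ (p + q) * \<Sigma>3)))
        = 1 / 2 * (((-1) ^ (q - 1) * (-1) ^ p) * a ^ n * b * ((2 * real n) ^ p / (2 * real n) ^ (p + q)) * fact (q - 1) * \<Sigma>3)"
        by (simp only: times_divide_eq_right times_divide_eq_left mult_ac)
      also have "(2 * real n) ^ p / (2 * real n) ^ (p + q) = 1 / (2 * real n) ^ q"
        using assms(3) by (simp add: power_add)
      also have "((-1) ^ (q - 1) * (-1) ^ p) * a ^ n = a ^ (n - 1)"
        unfolding sgn(1) an by (simp add: aa flip: mult.assoc)
      finally show ?thesis unfolding * T3_def by simp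
    qed
    ultimately show ?thesis unfolding V1_def by (simp only: distrib_left add.assoc)
  qed
  have g: "(?g has_integral (-1) ^ (p - 1) * V1 + 2 * (-1) ^ p * (a * T2)) {0<..<1}"
  proof -
    \<comment> \<open>The elementary part of the inversion formula at
      \<open>z = x ^ (2 * n)\<close>: since \<open>ln z = 2 * n * ln x\<close>, its logarithms merge
      with \<open>ln x ^ (q - 1)\<close>.\<close>
    let ?h = "\<lambda>x. \<Sum>k = 0..p div 2. 2 * (-1) ^ p * (b * Lerch b (2 * k) 1 * (2 * real n) ^ (p - 2 * k) / fact (p - 2 * k))
        * (ln x ^ (p + q - 2 * k - 1) / (1 - a * x\<^sup>2))"
    have "(?h has_integral (\<Sum>k = 0..p div 2. 2 * (-1) ^ p * (b * Lerch b (2 * k) 1 * (2 * real n) ^ (p - 2 * k) / fact (p - 2 * k))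
        * ((-1) ^ (p + q - 2 * k - 1) * fact (p + q - 2 * k - 1) * (Lerch a (Suc (p + q - 2 * k - 1)) (1/2) / 2 ^ Suc (p + q - 2 * k - 1))))) {0<..<1}"
      by (intro has_integral_sum has_integral_mult_right log_over_quadratic_has_integral a1) (use assms(2,7) in auto)
    moreover have "2 * (-1) ^ p * (b * Lerch b (2 * k) 1 * (2 * real n) ^ (p - 2 * k) / fact (p - 2 * k))
        * ((-1) ^ (p + q - 2 * k - 1) * fact (p + q - 2 * k - 1) * (Lerch a (Suc (p + q - 2 * k - 1)) (1/2) / 2 ^ Suc (p + q - 2 * k - 1)))
      = 2 * (-1) ^ p * (a * (b / 2 ^ q * real n ^ p * fact (q - 1))) * (real ((p + q - 2 * k - 1) choose (q - 1))
                 * real n powi (- 2 * int k) * Lerch b (2 * k) 1 * Lerch a (p + q - 2 * k) (1 / 2))"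
      if k: "k \<in> {0..p div 2}" for k
    proof -
      define m where "m = p - 2 * k"
      have m: "p = m + 2 * k" using k by (auto simp: m_def)
      have s: "p + q - 2 * k - 1 = m + q'" "p + q - 2 * k = Suc (m + q')" by (simp_all add: m Suc)
      \<comment> \<open>The sign of the integral is the same for every \<open>k\<close>, because
        \<open>2 * k\<close> leaves the parity of the exponent unchanged. Dividing
        \<open>fact (m + q')\<close> by \<open>fact m\<close> then creates the binomial coefficient
        and \<open>fact (q - 1)\<close>.\<close>
      have "(-1) ^ (m + q') = a" using assms(5) by (simp add: m Suc power_add power_mult)
      moreover have "fact (m + q') = real ((m + q') choose q') * fact q' * (fact m :: real)"
        by (simp add: binomial_fact)
      moreover have "(2 * real n) ^ m = 2 ^ m * real n ^ m" by (rule power_mult_distrib)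
      moreover have "(2::real) ^ Suc (m + q') = 2 ^ m * 2 ^ q" by (simp only: Suc(2) add_Suc_right[symmetric] power_add)
      moreover have "real n ^ p = real n ^ m * real n ^ (2 * k)" by (simp only: m power_add)
      moreover have "q - 1 = q'" by (simp add: Suc(2))
      moreover have "x1 * (b * x2 * (A * B) / F) * (a * (x3 * Q * F) * (x4 / (A * D)))
          = x1 * (a * (b / D * (B * E) * Q)) * (x3 * (1 / E) * x2 * x4)"
        if "A \<noteq> 0" "E \<noteq> 0" "F \<noteq> 0" "D \<noteq> 0" for x1 x2 x3 x4 A B D E F Q :: real
        using that by simp
      ultimately show ?thesis
        unfolding s powi_n m_def[symmetric] using assms(3) by simp
    qed
    ultimately have h: "(?h has_integral 2 * (-1) ^ p * (a * T2)) {0<..<1}"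
      unfolding T2_def \<Sigma>2_def by (simp add: sum_distrib_left mult.assoc)
    \<comment> \<open>The inversion holds pointwise on the open interval. For \<open>b = 1\<close>
      the principal value is inside \<open>Li\<close>, so the outer integral is an ordinary
      one.\<close>
    have "(-1) ^ (p - 1) * ?f x + ?h x = ?g x" if x: "x \<in> {0<..<1}" for x
    proof -
      define z where "z = x ^ (2 * n)"
      have z: "0 < z" "z < 1" using x assms(3) power_less_one_iff[of x "2 * n"] by (auto simp: z_def)
      have ln_z: "ln z = 2 * real n * ln x" using x by (simp add: z_def ln_realpow)
      have "- 2 * int n = - int (2 * n)" by simp
      then have "b * x powi (- 2 * int n) = b / z"
        by (simp only: power_int_minus power_int_of_nat z_def divide_inverse)
      then have "?g x = ln x ^ (q - 1) / (1 - a * x\<^sup>2) * Li p (b / z)" by simp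
      also have "\<dots> = (-1) ^ (p - 1) * ?f x + (\<Sum>k = 0..p div 2. ln x ^ (q - 1) / (1 - a * x\<^sup>2) * (2 * (-1) ^ p * (b * Lerch b (2 * k) 1 * ln z ^ (p - 2 * k) / fact (p - 2 * k))))"
        unfolding Li_inversion[OF assms(1,4) z] z_def[symmetric] sum_distrib_left[symmetric] by (simp add: algebra_simps)
      also have "(\<Sum>k = 0..p div 2. ln x ^ (q - 1) / (1 - a * x\<^sup>2) * (2 * (-1) ^ p * (b * Lerch b (2 * k) 1 * ln z ^ (p - 2 * k) / fact (p - 2 * k)))) = ?h x"
      proof (intro sum.cong refl)
        fix k assume "k \<in> {0..p div 2}"
        then have "p + q - 2 * k - 1 = (q - 1) + (p - 2 * k)" using assms(2) by auto
        then have "ln x ^ (p + q - 2 * k - 1) = ln x ^ (q - 1) * ln x ^ (p - 2 * k)" by (simp only: power_add)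
        then show "ln x ^ (q - 1) / (1 - a * x\<^sup>2) * (2 * (-1) ^ p * (b * Lerch b (2 * k) 1 * ln z ^ (p - 2 * k) / fact (p - 2 * k)))
          = 2 * (-1) ^ p * (b * Lerch b (2 * k) 1 * (2 * real n) ^ (p - 2 * k) / fact (p - 2 * k)) * (ln x ^ (p + q - 2 * k - 1) / (1 - a * x\<^sup>2))"
          unfolding ln_z by (simp only: power_mult_distrib times_divide_eq_right times_divide_eq_left divide_divide_eq_left mult_ac)
      qed
      finally show ?thesis by simp
    qed
    from has_integral_eq[OF this has_integral_add[OF has_integral_mult_right[OF f] h]] show ?thesis .
  qed
  have "(-1) ^ (p - 1) = - ((-1 :: real) ^ p)" by (simp add: Suc)
  \<comment> \<open>The correction is twice the \<open>T2\<close> part of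
    \<open>(-1) ^ p * V1\<close>. Up to the common sign \<open>(-1) ^ p\<close>, inversion therefore
    negates \<open>T1\<close> and \<open>T3\<close> and preserves \<open>T2\<close>.\<close>
  then have V2: "(-1) ^ (p - 1) * V1 + 2 * (-1) ^ p * (a * T2) = (-1) ^ p * (1/2) * T1 + (-1) ^ p * a * T2 - (-1) ^ p * (1/2) * T3"
    by (simp add: V1_def algebra_simps)
  have powi: "(x::real) powi (- int q) = 1 / x ^ q" for x
    by (simp only: power_int_minus power_int_of_nat inverse_eq_divide)
  have neg: "(- x) ^ q = (-1) ^ q * x ^ q" for x :: real by (simp flip: power_mult_distrib)
  have inv: "1 / ((-1) ^ q * y) = (-1) ^ q * (1 / y)" for y :: real by (cases "even q") auto
  have an': "a ^ n * (-1) ^ q = - ((-1) ^ p) * a ^ (n - 1)" 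
  proof -
    have "a ^ n * (-1) ^ q = ((-1) ^ q * a) * a ^ (n - 1)" by (simp add: an)
    then show ?thesis unfolding sgn(3) .
  qed
  show ?thesis
    unfolding c_def[symmetric] \<Sigma>2_def[symmetric] \<Sigma>3_def[symmetric]
  proof (intro conjI)
    have "V1 = - (1 / 2) * a ^ (n - 1) * b * 2 powi (- int q) * fact (q - 1) * (1 - (-1) ^ p) * Lerch a q (1 / 2) * Lerch c p 1
      + a * b * 2 powi (- int q) * real n ^ p * fact (q - 1) * \<Sigma>2
      + 1 / 2 * a ^ (n - 1) * b * (2 * real n) powi (- int q) * fact (q - 1) * \<Sigma>3"
      unfolding V1_def T1_def T2_def T3_def powi by simp
    then show "(?f has_integral - (1 / 2) * a ^ (n - 1) * b * 2 powi (- int q) * fact (q - 1) * (1 - (-1) ^ p) * Lerch a q (1 / 2) * Lerch c p 1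
      + a * b * 2 powi (- int q) * real n ^ p * fact (q - 1) * \<Sigma>2
      + 1 / 2 * a ^ (n - 1) * b * (2 * real n) powi (- int q) * fact (q - 1) * \<Sigma>3) {0<..<1}"
      using f by simp
    have p1: "- (1 / 2) * a ^ n * b * (-2) powi (- int q) * fact (q - 1) * (1 - (-1) ^ p) * Lerch a q (1 / 2) * Lerch c p 1
      = (-1) ^ p * (1/2) * T1"
    proof -
      have "- (1 / 2) * a ^ n * b * (-2) powi (- int q) * fact (q - 1) * (1 - (-1) ^ p) * Lerch a q (1 / 2) * Lerch c p 1
        = - (1 / 2) * (a ^ n * (-1) ^ q) * (b * (1 / 2 ^ q) * fact (q - 1) * (1 - (-1) ^ p) * Lerch a q (1 / 2) * Lerch c p 1)"
        unfolding powi neg[of 2] inv by (simp only: mult_ac)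
      then show ?thesis unfolding an' T1_def by simp
    qed
    have p2: "- (b * (-2) powi (- int q) * real n ^ p * fact (q - 1) * \<Sigma>2) = (-1) ^ p * a * T2"
      unfolding sgn(2) T2_def powi neg[of 2] inv by simp
    have p3: "1 / 2 * a ^ n * b * (- 2 * real n) powi (- int q) * fact (q - 1) * \<Sigma>3 = - ((-1) ^ p * (1/2) * T3)"
    proof -
      have m: "- 2 * real n = - (2 * real n)" by simp
      have "1 / 2 * a ^ n * b * (- 2 * real n) powi (- int q) * fact (q - 1) * \<Sigma>3
        = 1 / 2 * (a ^ n * (-1) ^ q) * (b * (1 / (2 * real n) ^ q) * fact (q - 1) * \<Sigma>3)"
        unfolding powi m neg[of "2 * real n"] inv by (simp only: mult_ac)
      then show ?thesis unfolding an' T3_def by simp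
    qed
    show "(?g has_integral - (1 / 2) * a ^ n * b * (-2) powi (- int q) * fact (q - 1) * (1 - (-1) ^ p) * Lerch a q (1 / 2) * Lerch c p 1
        - b * (-2) powi (- int q) * real n ^ p * fact (q - 1) * \<Sigma>2
        + 1 / 2 * a ^ n * b * (- 2 * real n) powi (- int q) * fact (q - 1) * \<Sigma>3) {0<..<1}"
      using g unfolding V2 p1[symmetric] p2[symmetric] by (simp only: p3 diff_conv_add_uminus)
  qed
qed

end
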